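(* There is a universal constant $C>0$ such that for every $n\ge2$ and every number $r\ge1$ of particles, the relaxation time $\tau$ of the ZRP with rate $1$ on the complete graph $K_n$ with $r$ particles satisfies $\tau\le C(\rho+1)^2$, where $\rho=r/n$. *)

theory Defs
  imports Complex_Main
begin

definition zrp_states :: "nat \<Rightarrow> nat \<Rightarrow> (nat \<Rightarrow> nat) set" where
  "zrp_states n r = {eta. (\<forall>i\<ge>n. eta i = 0) \<and> (\<Sum>i<n. eta i) = r}"

definition zrp_move :: "(nat \<Rightarrow> nat) \<Rightarrow> nat \<Rightarrow> nat \<Rightarrow> (nat \<Rightarrow> nat)" where
  "zrp_move eta x y = (eta(x := eta x - 1))(y := eta y + 1)"

text \<open>Transition rate: every occupied site x emits a particle at rate g(eta x) = 1,
  which jumps to a uniformly chosen neighbour y \<noteq> x of x in K_n.\<close>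
definition zrp_rate :: "nat \<Rightarrow> (nat \<Rightarrow> nat) \<Rightarrow> (nat \<Rightarrow> nat) \<Rightarrow> real" where
  "zrp_rate n eta eta' =
     (\<Sum>x<n. \<Sum>y<n. if x \<noteq> y \<and> 1 \<le> eta x \<and> zrp_move eta x y = eta'
                      then 1 / real (n - 1) else 0)"

text \<open>Stationary (reversible) distribution: for g \<equiv> 1 the ZRP invariant measure
  \<prod>_x 1/(g(1)\<cdots>g(eta x)) is uniform on the configurations.\<close>
definition zrp_pi :: "nat \<Rightarrow> nat \<Rightarrow> (nat \<Rightarrow> nat) \<Rightarrow> real" where
  "zrp_pi n r eta = 1 / real (card (zrp_states n r))"

definition zrp_mean :: "nat \<Rightarrow> nat \<Rightarrow> ((nat \<Rightarrow> nat) \<Rightarrow> real) \<Rightarrow> real" where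
  "zrp_mean n r f = (\<Sum>eta\<in>zrp_states n r. zrp_pi n r eta * f eta)"

definition zrp_var :: "nat \<Rightarrow> nat \<Rightarrow> ((nat \<Rightarrow> nat) \<Rightarrow> real) \<Rightarrow> real" where
  "zrp_var n r f = (\<Sum>eta\<in>zrp_states n r. zrp_pi n r eta * (f eta - zrp_mean n r f)^2)"

definition zrp_dirichlet :: "nat \<Rightarrow> nat \<Rightarrow> ((nat \<Rightarrow> nat) \<Rightarrow> real) \<Rightarrow> real" where
  "zrp_dirichlet n r f = (1/2) * (\<Sum>eta\<in>zrp_states n r. \<Sum>eta'\<in>zrp_states n r.
       zrp_pi n r eta * zrp_rate n eta eta' * (f eta - f eta')^2)"

definition zrp_gap :: "nat \<Rightarrow> nat \<Rightarrow> real" where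
  "zrp_gap n r = Inf {zrp_dirichlet n r f / zrp_var n r f | f. zrp_var n r f \<noteq> 0}"

definition zrp_relax_time :: "nat \<Rightarrow> nat \<Rightarrow> real" where
  "zrp_relax_time n r = 1 / zrp_gap n r"

end

theory Submission
  imports Defs "HOL-Analysis.Convex"
begin

text \<open>
  Write \<open>m\<close> for the number of sites, \<open>s\<close> for the number of particles and \<open>S = m + s\<close>. By induction on
  \<open>m\<close>, the variance is at most \<open>A S\<^sup>2 / m\<^sup>3\<close> times the sum of all squared gradients, with \<open>A\<close> universal.
  For the induction step one site \<open>x\<close> is revealed, chosen with probability
  \<open>p\<^sub>x = (\<eta>\<^sub>x + 1 + 3 S / m) / (4 S)\<close>: a mixture of a uniform and a size-biased choice. As \<open>p\<^sub>x\<close>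
  depends on \<open>\<eta>\<^sub>x\<close> only, the other sites stay uniformly distributed, so the variance splits into a part
  handled by the induction hypothesis and the variance of the conditional mean \<open>F\<^sub>x(\<eta>\<^sub>x)\<close>.
  The latter is bounded by a one-dimensional Hardy inequality; the increments of \<open>F\<^sub>x\<close> are averages of
  gradients, because adding a particle at \<open>y\<close> with probability proportional to \<open>\<eta>\<^sub>y + 1\<close> (Polya's urn)
  maps uniform configurations to uniform configurations. This produces gradients along \<open>x, y\<close> weighted
  by \<open>\<eta>\<^sub>x + \<eta>\<^sub>y + 2\<close>. Large piles are thus charged too much, but the size-biased choice reveals
  them early, and this gain in the first part absorbs the extra weight.
\<close>

section \<open>Configurations on a finite set of sites and their counting identities\<close>

definition conf :: "'a set \<Rightarrow> nat \<Rightarrow> ('a \<Rightarrow> nat) set" where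
  "conf X s = {\<eta>. (\<forall>i. i \<notin> X \<longrightarrow> \<eta> i = 0) \<and> sum \<eta> X = s}"

definition inc :: "'a \<Rightarrow> ('a \<Rightarrow> nat) \<Rightarrow> 'a \<Rightarrow> nat" where
  "inc x \<xi> = \<xi>(x := Suc (\<xi> x))"

definition conf_mean :: "'a set \<Rightarrow> nat \<Rightarrow> (('a \<Rightarrow> nat) \<Rightarrow> real) \<Rightarrow> real" where
  "conf_mean X s f = (\<Sum>\<eta>\<in>conf X s. f \<eta>) / real (card (conf X s))"

text \<open>Not divided by the number of configurations, and neither is \<open>conf_energy\<close>.
  Sums over slices then add up without cardinality factors, and the normalisation cancels when the
  two are compared.\<close>

definition conf_var :: "'a set \<Rightarrow> nat \<Rightarrow> (('a \<Rightarrow> nat) \<Rightarrow> real) \<Rightarrow> real" where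
  "conf_var X s f = (\<Sum>\<eta>\<in>conf X s. (f \<eta> - conf_mean X s f)\<^sup>2)"

text \<open>A jump from \<open>x\<close> to \<open>y\<close> is indexed by the configuration \<open>\<xi>\<close> of the particles that do not move.\<close>

definition conf_energy :: "'a set \<Rightarrow> nat \<Rightarrow> (('a \<Rightarrow> nat) \<Rightarrow> real) \<Rightarrow> real" where
  "conf_energy X r f = (\<Sum>\<xi>\<in>conf X r. \<Sum>x\<in>X. \<Sum>y\<in>X. (f (inc x \<xi>) - f (inc y \<xi>))\<^sup>2)"

lemma conf_energy_nonneg: "conf_energy X r f \<ge> 0"
  unfolding conf_energy_def by (intro sum_nonneg) auto

lemma conf_le: assumes "finite X" "\<eta> \<in> conf X s" shows "\<eta> i \<le> s"
proof (cases "i \<in> X")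
  case True
  then have "\<eta> i \<le> sum \<eta> X" using assms(1) by (intro member_le_sum) auto
  then show ?thesis using assms(2) by (simp add: conf_def)
next
  case False
  then show ?thesis using assms(2) by (simp add: conf_def)
qed

lemma finite_conf: assumes "finite X" shows "finite (conf X s)"
proof -
  have "conf X s \<subseteq> {\<eta>. \<forall>i. (i \<in> X \<longrightarrow> \<eta> i \<in> {..s}) \<and> (i \<notin> X \<longrightarrow> \<eta> i = 0)}"
    using conf_le[OF assms] by (auto simp: conf_def)
  then show ?thesis
    by (rule finite_subset) (intro finite_set_of_finite_funs assms finite_atMost)
qed

lemma conf_0: "finite X \<Longrightarrow> conf X 0 = {\<lambda>_. 0}"
  by (auto simp: conf_def)

lemma conf_nonempty: assumes "finite X" "X \<noteq> {}" shows "conf X s \<noteq> {}"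
proof -
  obtain x where "x \<in> X" using assms by auto
  then have "(\<lambda>i. if i = x then s else 0) \<in> conf X s"
    using assms by (auto simp: conf_def)
  then show ?thesis by auto
qed

lemma card_conf_pos: "finite X \<Longrightarrow> X \<noteq> {} \<Longrightarrow> card (conf X s) > 0"
  by (simp add: card_gt_0_iff conf_nonempty finite_conf)

text \<open>Revealing the number \<open>k\<close> of particles at \<open>x\<close> leaves a full
  configuration space on the other sites. Hence, given \<open>\<eta> x\<close>, a uniform
  configuration stays uniform off \<open>x\<close>.\<close>

lemma sum_conf_insert:
  fixes h :: "('a \<Rightarrow> nat) \<Rightarrow> 'b::comm_monoid_add"
  assumes "finite Y" "x \<notin> Y"
  shows "(\<Sum>\<eta>\<in>conf (insert x Y) s. h \<eta>) = (\<Sum>k\<le>s. \<Sum>\<zeta>\<in>conf Y (s - k). h (\<zeta>(x := k)))"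
proof -
  have s: "(\<Sum>i\<in>Y. if i = x then k else \<zeta> i) = sum \<zeta> Y" for \<zeta> :: "'a \<Rightarrow> nat" and k
    using assms by (intro sum.cong) auto
  have "(\<Sum>k\<le>s. \<Sum>\<zeta>\<in>conf Y (s - k). h (\<zeta>(x := k))) =
      (\<Sum>(k, \<zeta>)\<in>Sigma {..s} (\<lambda>k. conf Y (s - k)). h (\<zeta>(x := k)))"
    using finite_conf[OF assms(1)] by (subst sum.Sigma) auto
  also have "\<dots> = (\<Sum>\<eta>\<in>conf (insert x Y) s. h \<eta>)"
    by (rule sum.reindex_bij_witness[of _ "\<lambda>\<eta>. (\<eta> x, \<eta>(x := 0))" "\<lambda>(k, \<zeta>). \<zeta>(x := k)"])
      (use assms in \<open>auto simp: conf_def s fun_eq_iff\<close>)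
  finally show ?thesis ..
qed

text \<open>The pairs \<open>(\<xi>, x)\<close> correspond to the pairs \<open>(\<eta>, x)\<close>
  with \<open>x\<close> occupied in \<open>\<eta>\<close>, via \<open>\<eta> = inc x \<xi>\<close>.
  This links jumps indexed by the particles at rest to jumps indexed by their starting
  configuration.\<close>

lemma sum_conf_inc:
  fixes h :: "'a \<Rightarrow> ('a \<Rightarrow> nat) \<Rightarrow> 'b::comm_monoid_add"
  assumes "finite X"
  shows "(\<Sum>\<xi>\<in>conf X r. \<Sum>x\<in>X. h x (inc x \<xi>)) =
    (\<Sum>\<eta>\<in>conf X (Suc r). \<Sum>x\<in>X. if 1 \<le> \<eta> x then h x \<eta> else 0)"
proof -
  have s: "sum (\<zeta>(x := k)) X + \<zeta> x = sum \<zeta> X + k" if "x \<in> X" for \<zeta> :: "'a \<Rightarrow> nat" and k x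
  proof -
    have "sum (\<zeta>(x := k)) (X - {x}) = sum \<zeta> (X - {x})" by (intro sum.cong) auto
    then show ?thesis
      using sum.remove[OF assms that, of \<zeta>] sum.remove[OF assms that, of "\<zeta>(x := k)"] by simp
  qed
  have "(\<Sum>\<xi>\<in>conf X r. \<Sum>x\<in>X. h x (inc x \<xi>)) = (\<Sum>x\<in>X. \<Sum>\<xi>\<in>conf X r. h x (inc x \<xi>))"
    by (rule sum.swap)
  also have "\<dots> = (\<Sum>x\<in>X. \<Sum>\<eta> | \<eta> \<in> conf X (Suc r) \<and> 1 \<le> \<eta> x. h x \<eta>)"
  proof (rule sum.cong[OF refl])
    fix x assume x: "x \<in> X"
    show "(\<Sum>\<xi>\<in>conf X r. h x (inc x \<xi>)) = (\<Sum>\<eta> | \<eta> \<in> conf X (Suc r) \<and> 1 \<le> \<eta> x. h x \<eta>)"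
    proof (rule sum.reindex_bij_witness[of _ "\<lambda>\<eta>. \<eta>(x := \<eta> x - 1)" "inc x"])
      fix \<xi> assume "\<xi> \<in> conf X r"
      then show "inc x \<xi> \<in> {\<eta> \<in> conf X (Suc r). 1 \<le> \<eta> x}"
        using s[OF x, of \<xi> "Suc (\<xi> x)"] x by (auto simp: conf_def inc_def)
    next
      fix \<eta> assume "\<eta> \<in> {\<eta> \<in> conf X (Suc r). 1 \<le> \<eta> x}"
      then show "\<eta>(x := \<eta> x - 1) \<in> conf X r"
        using s[OF x, of \<eta> "\<eta> x - 1"] x by (auto simp: conf_def)
    qed (auto simp: inc_def fun_eq_iff)
  qed
  also have "\<dots> = (\<Sum>x\<in>X. \<Sum>\<eta>\<in>conf X (Suc r). if 1 \<le> \<eta> x then h x \<eta> else 0)"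
    using finite_conf[OF assms] by (intro sum.cong refl sum.inter_filter)
  also have "\<dots> = (\<Sum>\<eta>\<in>conf X (Suc r). \<Sum>x\<in>X. if 1 \<le> \<eta> x then h x \<eta> else 0)"
    by (rule sum.swap)
  finally show ?thesis .
qed

lemma sum_conf_polya:
  fixes h :: "('a \<Rightarrow> nat) \<Rightarrow> real"
  assumes "finite X"
  shows "(\<Sum>\<xi>\<in>conf X r. \<Sum>x\<in>X. (real (\<xi> x) + 1) * h (inc x \<xi>)) =
    (real r + 1) * (\<Sum>\<eta>\<in>conf X (Suc r). h \<eta>)"
proof -
  have "(\<Sum>\<xi>\<in>conf X r. \<Sum>x\<in>X. (real (\<xi> x) + 1) * h (inc x \<xi>)) =
     (\<Sum>\<xi>\<in>conf X r. \<Sum>x\<in>X. (\<lambda>x \<eta>. real (\<eta> x) * h \<eta>) x (inc x \<xi>))"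
    by (intro sum.cong refl) (auto simp: inc_def algebra_simps)
  also have "\<dots> = (\<Sum>\<eta>\<in>conf X (Suc r). \<Sum>x\<in>X. if 1 \<le> \<eta> x then real (\<eta> x) * h \<eta> else 0)"
    by (subst sum_conf_inc[OF assms]) simp
  also have "\<dots> = (\<Sum>\<eta>\<in>conf X (Suc r). \<Sum>x\<in>X. real (\<eta> x) * h \<eta>)"
    by (intro sum.cong refl) auto
  also have "\<dots> = (\<Sum>\<eta>\<in>conf X (Suc r). (real r + 1) * h \<eta>)"
  proof (rule sum.cong[OF refl])
    fix \<eta> assume "\<eta> \<in> conf X (Suc r)"
    then have "real (sum \<eta> X) = real r + 1" by (simp add: conf_def)
    then show "(\<Sum>x\<in>X. real (\<eta> x) * h \<eta>) = (real r + 1) * h \<eta>"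
      by (simp flip: sum_distrib_right)
  qed
  also have "\<dots> = (real r + 1) * (\<Sum>\<eta>\<in>conf X (Suc r). h \<eta>)"
    by (simp add: sum_distrib_left)
  finally show ?thesis .
qed

lemma sum_conf_shift:
  assumes "\<xi> \<in> conf X r"
  shows "(\<Sum>x\<in>X. real (\<xi> x) + 1) = real r + real (card X)"
proof -
  have "real (sum \<xi> X) = real r" using assms by (simp add: conf_def)
  then show ?thesis by (simp add: sum.distrib)
qed

text \<open>The urn identity for the constant function. This recursion and positivity are all that
  the one-dimensional estimates use about the counts; binomial coefficients never appear.\<close>

lemma card_conf_Suc:
  assumes "finite X"
  shows "(real r + real (card X)) * real (card (conf X r)) = (real r + 1) * real (card (conf X (Suc r)))"
proof -
  have "(\<Sum>\<xi>\<in>conf X r. \<Sum>x\<in>X. (real (\<xi> x) + 1) * 1) = (\<Sum>\<xi>\<in>conf X r. real r + real (card X))"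
    by (intro sum.cong refl) (simp add: sum_conf_shift)
  then show ?thesis using sum_conf_polya[OF assms, of "\<lambda>_. 1" r] by (simp add: mult.commute)
qed

lemma conf_mean_sum: "finite X \<Longrightarrow> X \<noteq> {} \<Longrightarrow>
  (\<Sum>\<eta>\<in>conf X s. f \<eta>) = real (card (conf X s)) * conf_mean X s f"
  unfolding conf_mean_def using card_conf_pos[of X s] by simp

text \<open>Used on a slice with \<open>c\<close> the global mean: it separates the variance within
  the slice from the deviation of the slice mean.\<close>

lemma sum_sq_shift_conf_mean:
  assumes "finite X" "X \<noteq> {}"
  shows "(\<Sum>\<eta>\<in>conf X s. (f \<eta> - c)\<^sup>2) =
    conf_var X s f + real (card (conf X s)) * (conf_mean X s f - c)\<^sup>2"
proof -
  let ?m = "conf_mean X s f"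
  have "(\<Sum>\<eta>\<in>conf X s. (f \<eta> - c)\<^sup>2) =
     (\<Sum>\<eta>\<in>conf X s. (f \<eta> - ?m)\<^sup>2 + (2 * (?m - c)) * f \<eta> + (c\<^sup>2 - ?m\<^sup>2))"
    by (intro sum.cong refl) (simp add: power2_eq_square algebra_simps)
  also have "\<dots> = conf_var X s f + (2 * (?m - c)) * (\<Sum>\<eta>\<in>conf X s. f \<eta>) + card (conf X s) * (c\<^sup>2 - ?m\<^sup>2)"
    by (simp add: sum.distrib conf_var_def sum_distrib_left)
  finally show ?thesis
    by (simp add: conf_mean_sum[OF assms]) (simp add: power2_eq_square algebra_simps)
qed

lemma conf_var_0: "finite X \<Longrightarrow> conf_var X 0 f = 0"
  by (simp add: conf_var_def conf_mean_def conf_0)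

section \<open>Weighted Jensen and Hardy inequalities in one dimension\<close>

lemma weighted_jensen_sq:
  fixes a g :: "'i \<Rightarrow> real"
  assumes "finite I" "\<And>i. i \<in> I \<Longrightarrow> a i \<ge> 0"
  shows "(\<Sum>i\<in>I. a i * g i)\<^sup>2 \<le> (\<Sum>i\<in>I. a i) * (\<Sum>i\<in>I. a i * (g i)\<^sup>2)"
proof -
  have "(\<Sum>i\<in>I. sqrt (a i) * (sqrt (a i) * g i))\<^sup>2 \<le>
     (\<Sum>i\<in>I. (sqrt (a i))\<^sup>2) * (\<Sum>i\<in>I. (sqrt (a i) * g i)\<^sup>2)"
    by (rule Cauchy_Schwarz_ineq_sum)
  moreover have "sqrt (a i) * (sqrt (a i) * g i) = a i * g i" if "i \<in> I" for i
    using assms(2)[OF that] by (metis abs_of_nonneg mult.assoc real_sqrt_mult_self)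
  ultimately show ?thesis using assms(2) by (simp add: power_mult_distrib cong: sum.cong)
qed

lemma abel_summation:
  fixes b H :: "nat \<Rightarrow> real"
  shows "(\<Sum>k\<le>s. b k * H k) =
    (\<Sum>k\<le>s. b k) * H 0 + (\<Sum>k<s. (\<Sum>j\<in>{Suc k..s}. b j) * (H (Suc k) - H k))"
proof (induction s)
  case (Suc s)
  have "(\<Sum>k<Suc s. (\<Sum>j\<in>{Suc k..Suc s}. b j) * (H (Suc k) - H k)) =
    (\<Sum>k<Suc s. (\<Sum>j\<in>{Suc k..s}. b j) * (H (Suc k) - H k) + b (Suc s) * (H (Suc k) - H k))"
    by (intro sum.cong refl) (auto simp: sum.nat_ivl_Suc' algebra_simps)
  also have "\<dots> = (\<Sum>k<s. (\<Sum>j\<in>{Suc k..s}. b j) * (H (Suc k) - H k)) + b (Suc s) * (H (Suc s) - H 0)"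
    by (simp add: sum.distrib sum_lessThan_telescope flip: sum_distrib_left)
  finally show ?case using Suc.IH by (simp add: algebra_simps)
qed simp

text \<open>Summation by parts turns the left side into tails of \<open>b\<close> times increments
  of \<open>(F k - F 0)\<^sup>2\<close>. The tail condition bounds each tail by the local weight,
  and Young's inequality returns half of the left side plus squared increments of
  \<open>F\<close>.\<close>

lemma discrete_hardy:
  fixes b B F :: "nat \<Rightarrow> real"
  assumes b: "\<And>k. k \<le> s \<Longrightarrow> b k \<ge> 0"
    and tail: "\<And>k. 1 \<le> k \<Longrightarrow> k \<le> s \<Longrightarrow> (\<Sum>j\<in>{k..s}. b j) \<le> B k * b k"
  shows "(\<Sum>k\<le>s. b k * (F k - F 0)\<^sup>2) \<le>
    4 * (\<Sum>k<s. b (Suc k) * (B (Suc k))\<^sup>2 * (F (Suc k) - F k)\<^sup>2)"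
proof -
  define G where "G k = F k - F 0" for k
  define Q where "Q k = (\<Sum>j\<in>{k..s}. b j)" for k
  let ?L = "\<Sum>k\<le>s. b k * (G k)\<^sup>2"
  have Q0: "Q k \<ge> 0" for k unfolding Q_def using b by (intro sum_nonneg) auto
  have step: "Q (Suc k) * ((G (Suc k))\<^sup>2 - (G k)\<^sup>2) \<le>
      b (Suc k) * (G (Suc k))\<^sup>2 / 2 + 2 * (b (Suc k) * (B (Suc k))\<^sup>2 * (F (Suc k) - F k)\<^sup>2)"
    if "k < s" for k
  proof -
    define d where "d = F (Suc k) - F k"
    define g where "g = \<bar>G (Suc k)\<bar>"
    define \<beta> where "\<beta> = b (Suc k)"
    define K where "K = B (Suc k)"
    have \<beta>: "\<beta> \<ge> 0" using b that unfolding \<beta>_def by auto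
    have Gk: "G k = G (Suc k) - d" by (simp add: G_def d_def)
    have "Q (Suc k) * ((G (Suc k))\<^sup>2 - (G k)\<^sup>2) \<le> Q (Suc k) * (2 * g * \<bar>d\<bar>)"
    proof (rule mult_left_mono[OF _ Q0])
      have "(G (Suc k))\<^sup>2 - (G k)\<^sup>2 \<le> 2 * (G (Suc k) * d)"
        unfolding Gk by (simp add: power2_eq_square algebra_simps)
      also have "G (Suc k) * d \<le> g * \<bar>d\<bar>" unfolding g_def by (metis abs_ge_self abs_mult)
      finally show "(G (Suc k))\<^sup>2 - (G k)\<^sup>2 \<le> 2 * g * \<bar>d\<bar>" by simp
    qed
    also have "\<dots> \<le> (K * \<beta>) * (2 * g * \<bar>d\<bar>)"
      using tail[of "Suc k"] that unfolding Q_def K_def \<beta>_def g_def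
      by (intro mult_right_mono) auto
    \<comment> \<open>Young's inequality, balanced so that the first term is exactly half of a term
      of the left side.\<close>
    also have "\<dots> \<le> \<beta> * g\<^sup>2 / 2 + 2 * (\<beta> * K\<^sup>2 * \<bar>d\<bar>\<^sup>2)"
    proof -
      have "0 \<le> \<beta> * (g - 2 * K * \<bar>d\<bar>)\<^sup>2" using \<beta> by simp
      then show ?thesis by (simp add: power2_eq_square algebra_simps)
    qed
    finally show ?thesis by (simp add: g_def \<beta>_def K_def d_def)
  qed
  have "?L = (\<Sum>k<s. Q (Suc k) * ((G (Suc k))\<^sup>2 - (G k)\<^sup>2))"
    unfolding Q_def using abel_summation[of b "\<lambda>k. (G k)\<^sup>2" s] by (simp add: G_def)
  also have "\<dots> \<le> (\<Sum>k<s. b (Suc k) * (G (Suc k))\<^sup>2 / 2 +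
      2 * (b (Suc k) * (B (Suc k))\<^sup>2 * (F (Suc k) - F k)\<^sup>2))"
    by (intro sum_mono step) auto
  also have "\<dots> = (\<Sum>k<s. b (Suc k) * (G (Suc k))\<^sup>2) / 2 +
      2 * (\<Sum>k<s. b (Suc k) * (B (Suc k))\<^sup>2 * (F (Suc k) - F k)\<^sup>2)"
    by (simp add: sum.distrib sum_distrib_left sum_divide_distrib)
  \<comment> \<open>The missing term \<open>k = 0\<close> vanishes because \<open>G 0 = 0\<close>.
    The estimate now reads \<open>?L \<le> ?L / 2 + 2 * R\<close>, where \<open>R\<close> is the sum
    on the right, which gives the constant 4.\<close>
  also have "(\<Sum>k<s. b (Suc k) * (G (Suc k))\<^sup>2) = ?L"
    by (simp add: G_def sum.atMost_shift)
  finally show ?thesis by (simp add: G_def)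
qed

section \<open>Hardy inequality for the occupation number of one site\<close>

text \<open>The hockey-stick identity, derived from the recursion alone: for \<open>M\<close> sites,
  \<open>c r\<close> stands for the number of configurations of \<open>r\<close> particles.\<close>

lemma polya_partial_sum:
  fixes c :: "nat \<Rightarrow> real"
  assumes "M > 0" "\<And>r. (real r + M) * c r = (real r + 1) * c (Suc r)"
  shows "(\<Sum>j\<le>J. c j) = c J * (real J + M) / M"
proof (induction J)
  case 0
  show ?case using assms by simp
next
  case (Suc J)
  have "(\<Sum>j\<le>Suc J. c j) = (real J + 1) * c (Suc J) / M + c (Suc J)"
    using Suc assms(2)[of J] by (simp add: mult.commute)
  then show ?case using assms(1) by (simp add: field_simps)
qed

text \<open>The hockey-stick identity summed once more: passing from \<open>J\<close> to
  \<open>J + 1\<close> raises each factor \<open>J - j\<close> by one and so adds one partial sum of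
  \<open>c\<close>.\<close>

lemma polya_partial_sum_linear:
  fixes c :: "nat \<Rightarrow> real"
  assumes "M > 0" "\<And>r. (real r + M) * c r = (real r + 1) * c (Suc r)"
  shows "(\<Sum>j\<le>J. (real J - real j) * c j) = c J * (real J + M) * real J / (M * (M + 1))"
proof (induction J)
  case (Suc J)
  have "(\<Sum>j\<le>Suc J. (real (Suc J) - real j) * c j) = (\<Sum>j\<le>J. (real J - real j) * c j + c j)"
    by (simp add: algebra_simps)
  also have "\<dots> = c J * (real J + M) * real J / (M * (M + 1)) + c J * (real J + M) / M"
    using Suc polya_partial_sum[OF assms] by (simp add: sum.distrib)
  also have "\<dots> = ((real J + M) * c J) * (real J + M + 1) / (M * (M + 1))"
    using assms(1) by (simp add: divide_simps) (simp add: algebra_simps)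
  also have "\<dots> = c (Suc J) * (real (Suc J) + M) * real (Suc J) / (M * (M + 1))"
    unfolding assms(2) by (simp add: algebra_simps)
  finally show ?case .
qed simp

text \<open>After reversing the index, the weight splits as
  \<open>(k + \<beta>) + ((s - k) - i)\<close>, and the two parts are the two partial sums above.
  The exact tail is what the Hardy condition asks for.\<close>

lemma polya_tail:
  fixes c :: "nat \<Rightarrow> real"
  assumes "M > 0" "\<And>r. (real r + M) * c r = (real r + 1) * c (Suc r)" "k \<le> s"
  shows "(\<Sum>j\<in>{k..s}. c (s - j) * (real j + \<beta>)) =
    c (s - k) * (real (s - k) + M) / M * (real k + \<beta> + real (s - k) / (M + 1))"
proof -
  have "(\<Sum>j\<in>{k..s}. c (s - j) * (real j + \<beta>)) = (\<Sum>i\<le>s - k. c i * (real s - real i + \<beta>))"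
    by (rule sum.reindex_bij_witness[of _ "\<lambda>i. s - i" "\<lambda>j. s - j"]) (use assms in auto)
  also have "\<dots> = (\<Sum>i\<le>s - k. (real k + \<beta>) * c i + (real (s - k) - real i) * c i)"
    using assms by (intro sum.cong refl) (simp add: algebra_simps)
  also have "\<dots> = (real k + \<beta>) * (c (s - k) * (real (s - k) + M) / M) +
     c (s - k) * (real (s - k) + M) * real (s - k) / (M * (M + 1))"
    using polya_partial_sum[OF assms(1,2)] polya_partial_sum_linear[OF assms(1,2)]
    by (simp add: sum.distrib flip: sum_distrib_left)
  also have "\<dots> = c (s - k) * (real (s - k) + M) / M * (real k + \<beta> + real (s - k) / (M + 1))"
    using assms(1) by (simp add: divide_simps) (simp add: algebra_simps)
  finally show ?thesis .
qed

text \<open>The factor \<open>k + \<beta>\<close> is, up to scaling, the probability of revealing a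
  site with \<open>k\<close> particles. The assumption on \<open>\<beta>\<close> keeps the uniform
  part of that choice large enough for the weighted tail to be comparable with the unweighted
  one.\<close>

lemma weighted_hardy_polya:
  fixes c F :: "nat \<Rightarrow> real"
  assumes M: "M \<ge> 1" and c: "\<And>r. (real r + M) * c r = (real r + 1) * c (Suc r)"
    and c0: "\<And>r. c r \<ge> 0" and \<beta>: "\<beta> > 0" "3 * real s \<le> \<beta> * (M + 1)"
  shows "(\<Sum>k\<le>s. c (s - k) * (real k + \<beta>) * (F k - F 0)\<^sup>2) \<le>
    256 / (9 * (M + 1)\<^sup>2) * (\<Sum>k<s. c (s - Suc k) * (real k + 1 + \<beta>) *
      (real (s - Suc k) + M)\<^sup>2 * (F (Suc k) - F k)\<^sup>2)"
proof -
  define b where "b k = c (s - k) * (real k + \<beta>)" for k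
  define B where "B k = 4 / 3 * (real (s - k) + M) / M" for k
  have b0: "b k \<ge> 0" for k using c0 \<beta> by (simp add: b_def)
  have "(\<Sum>k\<le>s. b k * (F k - F 0)\<^sup>2) \<le>
      4 * (\<Sum>k<s. b (Suc k) * (B (Suc k))\<^sup>2 * (F (Suc k) - F k)\<^sup>2)"
  proof (rule discrete_hardy)
    fix k assume k: "1 \<le> k" "k \<le> s"
    \<comment> \<open>The correction term in the exact tail costs at most a factor 4/3; this is the
      4/3 in \<open>B\<close>.\<close>
    have "real (s - k) / (M + 1) \<le> \<beta> / 3"
      using M \<beta>(2) k by (simp add: field_simps)
    then have *: "real k + \<beta> + real (s - k) / (M + 1) \<le> 4 / 3 * (real k + \<beta>)" by simp
    have "(\<Sum>j\<in>{k..s}. b j) =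
        c (s - k) * (real (s - k) + M) / M * (real k + \<beta> + real (s - k) / (M + 1))"
      unfolding b_def using M k by (intro polya_tail c) auto
    also have "\<dots> \<le> c (s - k) * (real (s - k) + M) / M * (4 / 3 * (real k + \<beta>))"
      using c0 M by (intro mult_left_mono *) simp
    also have "\<dots> = B k * b k" using M by (simp add: b_def B_def field_simps)
    finally show "(\<Sum>j\<in>{k..s}. b j) \<le> B k * b k" .
  qed (rule b0)
  also have "\<dots> = (\<Sum>k<s. 4 * (b (Suc k) * (B (Suc k))\<^sup>2 * (F (Suc k) - F k)\<^sup>2))"
    by (simp add: sum_distrib_left)
  also have "\<dots> \<le> (\<Sum>k<s. 256 / (9 * (M + 1)\<^sup>2) * (b (Suc k) *
      (real (s - Suc k) + M)\<^sup>2 * (F (Suc k) - F k)\<^sup>2))"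
  proof (rule sum_mono)
    fix k
    have "4 * (B (Suc k))\<^sup>2 = 64 / (9 * M\<^sup>2) * (real (s - Suc k) + M)\<^sup>2"
      by (simp add: B_def power_divide power_mult_distrib power2_eq_square field_simps)
    also have "\<dots> \<le> 256 / (9 * (M + 1)\<^sup>2) * (real (s - Suc k) + M)\<^sup>2"
    proof (rule mult_right_mono)
      \<comment> \<open>As \<open>M \<ge> 1\<close>, trading \<open>M\<close> for
        \<open>M + 1\<close> costs a factor 4 and turns 64/9 into 256/9.\<close>
      have "(M + 1)\<^sup>2 \<le> (2 * M)\<^sup>2" using M by (intro power_mono) auto
      then show "64 / (9 * M\<^sup>2) \<le> 256 / (9 * (M + 1)\<^sup>2)"
        using M by (simp add: divide_simps power_mult_distrib)
    qed simp
    finally have "(b (Suc k) * (F (Suc k) - F k)\<^sup>2) * (4 * (B (Suc k))\<^sup>2) \<le>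
        (b (Suc k) * (F (Suc k) - F k)\<^sup>2) * (256 / (9 * (M + 1)\<^sup>2) * (real (s - Suc k) + M)\<^sup>2)"
      using b0 by (intro mult_left_mono) auto
    then show "4 * (b (Suc k) * (B (Suc k))\<^sup>2 * (F (Suc k) - F k)\<^sup>2) \<le>
        256 / (9 * (M + 1)\<^sup>2) * (b (Suc k) * (real (s - Suc k) + M)\<^sup>2 * (F (Suc k) - F k)\<^sup>2)"
      by (simp only: mult_ac)
  qed
  finally show ?thesis by (simp add: b_def sum_distrib_left add_ac)
qed

text \<open>The centre \<open>\<mu>\<close> is the mean for the plain counts, not for the weights
  \<open>c (s - k) * (k + \<beta>)\<close>, so it does not minimise the left side. Moving the centre
  from \<open>F 0\<close> to \<open>\<mu>\<close> is paid for by bounding \<open>F 0 - \<mu>\<close>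
  through the Hardy sum itself.\<close>

lemma weighted_hardy_polya_mean:
  fixes c F :: "nat \<Rightarrow> real"
  assumes M: "M \<ge> 1" and c: "\<And>r. (real r + M) * c r = (real r + 1) * c (Suc r)"
    and c0: "\<And>r. c r > 0" and \<beta>: "\<beta> > 0" "3 * real s \<le> \<beta> * (M + 1)"
    and mean: "(\<Sum>k\<le>s. c (s - k) * (F k - \<mu>)) = 0"
  shows "(\<Sum>k\<le>s. c (s - k) * (real k + \<beta>) * (F k - \<mu>)\<^sup>2) \<le>
    134 / (M + 1)\<^sup>2 * (\<Sum>k<s. c (s - Suc k) * (real k + 1 + \<beta>) *
      (real (s - Suc k) + M)\<^sup>2 * (F (Suc k) - F k)\<^sup>2)"
proof -
  define a where "a k = c (s - k)" for k
  define w where "w k = real k + \<beta>" for k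
  define N where "N = (\<Sum>k\<le>s. a k)"
  define H where "H = (\<Sum>k\<le>s. a k * w k * (F k - F 0)\<^sup>2)"
  define R where "R = (\<Sum>k<s. c (s - Suc k) * (real k + 1 + \<beta>) *
      (real (s - Suc k) + M)\<^sup>2 * (F (Suc k) - F k)\<^sup>2)"
  have a0: "a k > 0" for k by (simp add: a_def c0)
  have w0: "w k > 0" for k using \<beta> by (simp add: w_def)
  have N0: "N > 0" unfolding N_def by (rule sum_pos) (auto simp: a0)
  have H0: "H \<ge> 0" unfolding H_def using a0 w0 by (intro sum_nonneg) (simp add: less_imp_le)
  have R0: "R \<ge> 0" unfolding R_def using \<beta> by (intro sum_nonneg) (simp add: less_imp_le c0)
  have HR: "H \<le> 256 / (9 * (M + 1)\<^sup>2) * R"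
    unfolding H_def R_def a_def w_def
    by (rule weighted_hardy_polya[OF M c _ \<beta>]) (simp add: less_imp_le c0)
  have N_eq: "N = a 0 * (real s + M) / M"
  proof -
    have "N = (\<Sum>j\<le>s. c j)" unfolding N_def a_def
      by (rule sum.reindex_bij_witness[of _ "\<lambda>j. s - j" "\<lambda>k. s - k"]) auto
    then show ?thesis using polya_partial_sum[OF _ c, of s] M by (simp add: a_def)
  qed
  have Aw: "(\<Sum>k\<le>s. a k * w k) \<le> 4 / 3 * \<beta> * N"
  proof -
    have "(\<Sum>k\<le>s. a k * w k) = N * (\<beta> + real s / (M + 1))"
      using polya_tail[OF _ c, of 0 s \<beta>] M by (simp add: N_eq a_def w_def atMost_atLeast0)
    also have "\<dots> \<le> N * (4 / 3 * \<beta>)"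
      using N0 \<beta>(2) M by (intro mult_left_mono) (auto simp: field_simps)
    finally show ?thesis by (simp add: mult_ac)
  qed
  \<comment> \<open>Since \<open>\<mu>\<close> is the mean, \<open>F 0 - \<mu>\<close> is an average
    of the differences \<open>F 0 - F k\<close>, to which Jensen applies.\<close>
  have "N * (F 0 - \<mu>) = (\<Sum>k\<le>s. a k * (F 0 - F k))"
  proof -
    have "(\<Sum>k\<le>s. a k * (F 0 - F k)) + (\<Sum>k\<le>s. a k * (F k - \<mu>)) = (\<Sum>k\<le>s. a k * (F 0 - \<mu>))"
      unfolding sum.distrib[symmetric] by (simp add: algebra_simps)
    then show ?thesis using mean by (simp add: a_def N_def sum_distrib_right)
  qed
  then have "(N * (F 0 - \<mu>))\<^sup>2 \<le> N * (\<Sum>k\<le>s. a k * (F 0 - F k)\<^sup>2)"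
    unfolding N_def by (simp add: weighted_jensen_sq less_imp_le a0)
  then have "N * (F 0 - \<mu>)\<^sup>2 \<le> (\<Sum>k\<le>s. a k * (F 0 - F k)\<^sup>2)"
    using N0 by (simp add: power_mult_distrib power2_eq_square mult.left_commute)
  \<comment> \<open>The extra weight comes in for free because
    \<open>w k \<ge> \<beta>\<close>.\<close>
  also have "\<dots> \<le> (\<Sum>k\<le>s. a k * w k * (F k - F 0)\<^sup>2 / \<beta>)"
  proof (rule sum_mono)
    fix k
    have "a k * (F 0 - F k)\<^sup>2 * 1 \<le> a k * (F 0 - F k)\<^sup>2 * (w k / \<beta>)"
      using a0[of k] \<beta> by (intro mult_left_mono) (auto simp: w_def)
    then show "a k * (F 0 - F k)\<^sup>2 \<le> a k * w k * (F k - F 0)\<^sup>2 / \<beta>"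
      by (simp add: power2_commute mult_ac)
  qed
  also have "\<dots> = H / \<beta>" by (simp add: H_def sum_divide_distrib)
  finally have F0: "\<beta> * N * (F 0 - \<mu>)\<^sup>2 \<le> H" using \<beta> by (simp add: field_simps)
  have "(\<Sum>k\<le>s. a k * w k * (F k - \<mu>)\<^sup>2) \<le>
      (\<Sum>k\<le>s. 2 * (a k * w k * (F k - F 0)\<^sup>2) + 2 * (F 0 - \<mu>)\<^sup>2 * (a k * w k))"
  proof (rule sum_mono)
    fix k
    have "(F k - \<mu>)\<^sup>2 \<le> 2 * (F k - F 0)\<^sup>2 + 2 * (F 0 - \<mu>)\<^sup>2"
    proof -
      have "0 \<le> ((F k - F 0) - (F 0 - \<mu>))\<^sup>2" by simp
      then show ?thesis by (simp add: power2_eq_square algebra_simps)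
    qed
    then have "a k * w k * (F k - \<mu>)\<^sup>2 \<le> a k * w k * (2 * (F k - F 0)\<^sup>2 + 2 * (F 0 - \<mu>)\<^sup>2)"
      using a0[of k] w0[of k] by (intro mult_left_mono) auto
    then show "a k * w k * (F k - \<mu>)\<^sup>2 \<le>
        2 * (a k * w k * (F k - F 0)\<^sup>2) + 2 * (F 0 - \<mu>)\<^sup>2 * (a k * w k)"
      by (simp add: algebra_simps)
  qed
  also have "\<dots> = 2 * H + 2 * (F 0 - \<mu>)\<^sup>2 * (\<Sum>k\<le>s. a k * w k)"
    by (simp add: sum.distrib H_def sum_distrib_left)
  also have "\<dots> \<le> 2 * H + 2 * (F 0 - \<mu>)\<^sup>2 * (4 / 3 * \<beta> * N)"
    by (intro add_left_mono mult_left_mono Aw) auto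
  \<comment> \<open>By \<open>F0\<close> the second summand is at most \<open>8 / 3 * H\<close>, and
    2 + 8/3 = 14/3.\<close>
  also have "\<dots> \<le> 14 / 3 * H" using F0 by (simp add: algebra_simps)
  also have "\<dots> \<le> 14 / 3 * (256 / (9 * (M + 1)\<^sup>2) * R)" using HR by simp
  also have "\<dots> = 3584 / 27 * (R / (M + 1)\<^sup>2)" by simp
  also have "\<dots> \<le> 134 * (R / (M + 1)\<^sup>2)" using R0 by (intro mult_right_mono) auto
  finally show ?thesis by (simp add: a_def w_def R_def)
qed

section \<open>The conditional mean given one site\<close>

text \<open>One urn step on \<open>Y\<close> couples uniform configurations with \<open>j\<close>
  and \<open>j + 1\<close> particles. Under this coupling the two means differ by an average of
  gradients between \<open>x\<close> and the site \<open>y\<close> that receives the particle, and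
  Jensen gives the bound.\<close>

lemma conf_mean_diff_polya:
  fixes f :: "('a \<Rightarrow> nat) \<Rightarrow> real"
  assumes Y: "finite Y" "Y \<noteq> {}" and x: "x \<notin> Y"
  shows "real (card (conf Y j)) * (real j + real (card Y)) *
      (conf_mean Y j (\<lambda>\<zeta>. f (\<zeta>(x := Suc k))) - conf_mean Y (Suc j) (\<lambda>\<zeta>. f (\<zeta>(x := k))))\<^sup>2 \<le>
    (\<Sum>\<zeta>\<in>conf Y j. \<Sum>y\<in>Y. (real (\<zeta> y) + 1) * (f (inc x (\<zeta>(x := k))) - f (inc y (\<zeta>(x := k))))\<^sup>2)"
proof -
  define T where "T = real (card (conf Y j)) * (real j + real (card Y))"
  define I where "I = conf Y j \<times> Y"
  define \<Delta> where "\<Delta> = conf_mean Y j (\<lambda>\<zeta>. f (\<zeta>(x := Suc k))) - conf_mean Y (Suc j) (\<lambda>\<zeta>. f (\<zeta>(x := k)))"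
  define a :: "('a \<Rightarrow> nat) \<times> 'a \<Rightarrow> real" where "a = (\<lambda>(\<zeta>, y). real (\<zeta> y) + 1)"
  define g where "g = (\<lambda>(\<zeta>, y). f (inc x (\<zeta>(x := k))) - f (inc y (\<zeta>(x := k))))"
  have T0: "T > 0" unfolding T_def using Y card_conf_pos[OF Y, of j]
    by (simp add: card_gt_0_iff add_nonneg_pos)
  have fin: "finite I" unfolding I_def using finite_conf Y by auto
  have sh: "(\<Sum>y\<in>Y. real (\<zeta> y) + 1) = real j + real (card Y)" if "\<zeta> \<in> conf Y j" for \<zeta>
    using that by (rule sum_conf_shift)
  have T: "(\<Sum>i\<in>I. a i) = T"
    unfolding I_def a_def T_def by (simp add: sum.cartesian_product[symmetric] sh)
  have "(\<Sum>i\<in>I. a i * g i) =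
      (\<Sum>\<zeta>\<in>conf Y j. \<Sum>y\<in>Y. (real (\<zeta> y) + 1) * f (\<zeta>(x := Suc k))) -
      (\<Sum>\<zeta>\<in>conf Y j. \<Sum>y\<in>Y. (real (\<zeta> y) + 1) * (\<lambda>\<zeta>. f (\<zeta>(x := k))) (inc y \<zeta>))"
  proof -
    have "inc x (\<zeta>(x := k)) = \<zeta>(x := Suc k)" for \<zeta> :: "'a \<Rightarrow> nat" by (simp add: inc_def)
    moreover have "inc y (\<zeta>(x := k)) = (inc y \<zeta>)(x := k)" if "y \<in> Y" for y and \<zeta> :: "'a \<Rightarrow> nat"
      using that x by (auto simp: inc_def fun_eq_iff)
    moreover have "(\<Sum>i\<in>I. a i * g i) = (\<Sum>\<zeta>\<in>conf Y j. \<Sum>y\<in>Y.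
        (real (\<zeta> y) + 1) * (f (inc x (\<zeta>(x := k))) - f (inc y (\<zeta>(x := k)))))"
      by (simp add: I_def a_def g_def sum.cartesian_product split_def)
    ultimately show ?thesis
      by (simp add: sum_subtractf[symmetric] right_diff_distrib cong: sum.cong)
  qed
  also have "\<dots> = (\<Sum>\<zeta>\<in>conf Y j. (real j + real (card Y)) * f (\<zeta>(x := Suc k))) -
      (real j + 1) * (\<Sum>\<zeta>\<in>conf Y (Suc j). f (\<zeta>(x := k)))"
    using sum_conf_polya[OF Y(1), of "\<lambda>\<zeta>. f (\<zeta>(x := k))" j]
    by (simp add: sum_distrib_right[symmetric] sh)
  also have "\<dots> = (real j + real (card Y)) * (real (card (conf Y j)) * conf_mean Y j (\<lambda>\<zeta>. f (\<zeta>(x := Suc k)))) -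
      (real j + 1) * (real (card (conf Y (Suc j))) * conf_mean Y (Suc j) (\<lambda>\<zeta>. f (\<zeta>(x := k))))"
    by (simp add: sum_distrib_left[symmetric] conf_mean_sum[OF Y])
  \<comment> \<open>By \<open>card_conf_Suc\<close> both means carry the same normalisation
    \<open>T\<close>.\<close>
  also have "\<dots> = T * \<Delta>"
    unfolding T_def \<Delta>_def right_diff_distrib mult.assoc[symmetric] card_conf_Suc[OF Y(1), symmetric]
    by (simp only: mult_ac)
  finally have "(T * \<Delta>)\<^sup>2 \<le> T * (\<Sum>i\<in>I. a i * (g i)\<^sup>2)"
    using weighted_jensen_sq[OF fin, of a g] T by (auto simp: a_def)
  then have "T * \<Delta>\<^sup>2 \<le> (\<Sum>i\<in>I. a i * (g i)\<^sup>2)"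
    using T0 by (simp add: power_mult_distrib power2_eq_square mult.left_commute)
  then show ?thesis
    unfolding I_def a_def g_def T_def \<Delta>_def
    by (simp add: sum.cartesian_product split_def)
qed

text \<open>Moving from \<open>x\<close> to \<open>y\<close> through a uniformly chosen \<open>z\<close> trades the product weight for a linear one.\<close>

lemma sum_sq_diff_via_uniform:
  fixes a g :: "'i \<Rightarrow> real"
  assumes "finite X" "\<And>x. x \<in> X \<Longrightarrow> a x \<ge> 0"
  shows "real (card X) * (\<Sum>x\<in>X. \<Sum>y\<in>X. a x * a y * (g x - g y)\<^sup>2) \<le>
    4 * (\<Sum>x\<in>X. a x) * (\<Sum>x\<in>X. \<Sum>z\<in>X. a x * (g x - g z)\<^sup>2)"
proof -
  let ?A = "\<Sum>x\<in>X. a x" and ?R = "\<Sum>x\<in>X. \<Sum>z\<in>X. a x * (g x - g z)\<^sup>2"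
  have "real (card X) * (\<Sum>x\<in>X. \<Sum>y\<in>X. a x * a y * (g x - g y)\<^sup>2) =
      (\<Sum>x\<in>X. \<Sum>y\<in>X. \<Sum>z\<in>X. a x * a y * (g x - g y)\<^sup>2)"
    by (simp add: sum_distrib_left)
  also have "\<dots> \<le> (\<Sum>x\<in>X. \<Sum>y\<in>X. \<Sum>z\<in>X. 2 * (a y * (a x * (g x - g z)\<^sup>2)) + 2 * (a x * (a y * (g y - g z)\<^sup>2)))"
  proof (intro sum_mono)
    fix x y z assume xyz: "x \<in> X" "y \<in> X" "z \<in> X"
    have "0 \<le> ((g x - g z) + (g y - g z))\<^sup>2" by simp
    then have "(g x - g y)\<^sup>2 \<le> 2 * (g x - g z)\<^sup>2 + 2 * (g y - g z)\<^sup>2"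
      by (simp add: power2_eq_square algebra_simps)
    then have "a x * a y * (g x - g y)\<^sup>2 \<le> a x * a y * (2 * (g x - g z)\<^sup>2 + 2 * (g y - g z)\<^sup>2)"
      using assms xyz by (intro mult_left_mono) auto
    then show "a x * a y * (g x - g y)\<^sup>2 \<le>
        2 * (a y * (a x * (g x - g z)\<^sup>2)) + 2 * (a x * (a y * (g y - g z)\<^sup>2))"
      by (simp add: algebra_simps)
  qed
  also have "\<dots> = 2 * (\<Sum>x\<in>X. \<Sum>y\<in>X. a y * (\<Sum>z\<in>X. a x * (g x - g z)\<^sup>2)) +
      2 * (\<Sum>x\<in>X. \<Sum>y\<in>X. a x * (\<Sum>z\<in>X. a y * (g y - g z)\<^sup>2))"
    by (simp add: sum.distrib sum_distrib_left)
  also have "(\<Sum>x\<in>X. \<Sum>y\<in>X. a y * (\<Sum>z\<in>X. a x * (g x - g z)\<^sup>2)) = ?A * ?R"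
    by (subst sum.swap) (simp add: sum_product)
  also have "(\<Sum>x\<in>X. \<Sum>y\<in>X. a x * (\<Sum>z\<in>X. a y * (g y - g z)\<^sup>2)) = ?A * ?R"
    by (simp add: sum_product)
  finally show ?thesis by simp
qed

text \<open>The tower property of conditional means, in the form of the mean hypothesis of
  \<open>weighted_hardy_polya_mean\<close>.\<close>

lemma sum_card_conf_mean_slices:
  assumes "finite Y" "Y \<noteq> {}" "x \<notin> Y"
  shows "(\<Sum>k\<le>s. real (card (conf Y (s - k))) *
      (conf_mean Y (s - k) (\<lambda>\<zeta>. f (\<zeta>(x := k))) - conf_mean (insert x Y) s f)) = 0"
proof -
  let ?\<mu> = "conf_mean (insert x Y) s f"
  have "(\<Sum>k\<le>s. real (card (conf Y (s - k))) *
      (conf_mean Y (s - k) (\<lambda>\<zeta>. f (\<zeta>(x := k))) - ?\<mu>)) =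
      (\<Sum>k\<le>s. \<Sum>\<zeta>\<in>conf Y (s - k). f (\<zeta>(x := k)) - ?\<mu>)"
    by (simp add: right_diff_distrib conf_mean_sum[OF assms(1,2)] sum_subtractf)
  also have "\<dots> = (\<Sum>\<eta>\<in>conf (insert x Y) s. f \<eta> - ?\<mu>)"
    by (rule sum_conf_insert[OF assms(1,3), of "\<lambda>\<eta>. f \<eta> - ?\<mu>", symmetric])
  also have "\<dots> = 0"
    using conf_mean_sum[of "insert x Y" f s] assms by (simp add: sum_subtractf)
  finally show ?thesis .
qed

text \<open>Hardy's inequality bounds the variance of the conditional mean by its increments, and
  the urn coupling bounds the increments by gradients. The choice
  \<open>\<beta> = 1 + 3 * S / m\<close> makes \<open>k + \<beta>\<close> equal to
  \<open>4 * S\<close> times the revealing probability.\<close>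

lemma site_estimate:
  fixes f :: "('a \<Rightarrow> nat) \<Rightarrow> real"
  assumes Y: "finite Y" "Y \<noteq> {}" and x: "x \<notin> Y"
    and X: "X = insert x Y" and m: "m = real (card X)" and S: "S = m + real (Suc r)"
  shows "(\<Sum>k\<le>Suc r. real (card (conf Y (Suc r - k))) * (real k + 1 + 3 * S / m) *
      (conf_mean Y (Suc r - k) (\<lambda>\<zeta>. f (\<zeta>(x := k))) - conf_mean X (Suc r) f)\<^sup>2) \<le>
    134 * S / m\<^sup>2 * (\<Sum>\<xi>\<in>conf X r. \<Sum>y\<in>X. (real (\<xi> x) + 2 + 3 * S / m) * (real (\<xi> y) + 1) *
      (f (inc x \<xi>) - f (inc y \<xi>))\<^sup>2)"
proof -
  define M where "M = real (card Y)"
  define c where "c j = real (card (conf Y j))" for j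
  define \<beta> where "\<beta> = 1 + 3 * S / m"
  define F where "F k = conf_mean Y (Suc r - k) (\<lambda>\<zeta>. f (\<zeta>(x := k)))" for k
  have M1: "M \<ge> 1" unfolding M_def using Y
    by (metis One_nat_def Suc_leI card_gt_0_iff of_nat_1 of_nat_le_iff)
  have mM: "m = M + 1" using Y x by (simp add: m X M_def)
  have \<beta>0: "\<beta> > 0" unfolding \<beta>_def using M1 mM S by (intro add_pos_nonneg) auto
  have \<beta>s: "3 * real (Suc r) \<le> \<beta> * (M + 1)"
  proof -
    have "\<beta> * (M + 1) = m + 3 * S" using M1 mM by (simp add: \<beta>_def field_simps)
    then show ?thesis using M1 mM S by simp
  qed
  have term_le: "c (Suc r - Suc k) * (real k + 1 + \<beta>) * (real (Suc r - Suc k) + M)\<^sup>2 * (F (Suc k) - F k)\<^sup>2 \<le>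
      S * (\<Sum>\<zeta>\<in>conf Y (r - k). \<Sum>y\<in>Y. (real k + 1 + \<beta>) * (real (\<zeta> y) + 1) *
        (f (inc x (\<zeta>(x := k))) - f (inc y (\<zeta>(x := k))))\<^sup>2)"
    (is "_ \<le> S * ?E") if "k \<le> r" for k
  proof -
    define j where "j = r - k"
    have j: "Suc r - Suc k = j" "Suc r - k = Suc j" using that by (auto simp: j_def)
    have kb: "real k + 1 + \<beta> \<ge> 0" using \<beta>0 by simp
    have "real (card (conf Y j)) * (real j + M) * (F (Suc k) - F k)\<^sup>2 \<le>
        (\<Sum>\<zeta>\<in>conf Y j. \<Sum>y\<in>Y. (real (\<zeta> y) + 1) * (f (inc x (\<zeta>(x := k))) - f (inc y (\<zeta>(x := k))))\<^sup>2)"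
      (is "?lhs \<le> ?E'") unfolding F_def j M_def by (rule conf_mean_diff_polya[OF Y x])
    then have le: "(real k + 1 + \<beta>) * ?lhs \<le> (real k + 1 + \<beta>) * ?E'"
      using kb by (rule mult_left_mono)
    have E: "(real k + 1 + \<beta>) * ?E' = ?E"
      unfolding j_def sum_distrib_left by (simp only: mult_ac)
    have E0: "?E \<ge> 0" using kb by (intro sum_nonneg mult_nonneg_nonneg) auto
    have "(real j + M) * ((real k + 1 + \<beta>) * ?lhs) \<le> (real j + M) * ?E"
      using le M1 unfolding E by (intro mult_left_mono) auto
    \<comment> \<open>Of the two factors \<open>j + M\<close> from Hardy's inequality, one is used
      up by the coupling bound; the other is at most \<open>S\<close>.\<close>
    also have "\<dots> \<le> S * ?E" using mM S by (intro mult_right_mono E0) (simp add: j_def)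
    finally show ?thesis unfolding j c_def power2_eq_square by (simp only: mult_ac)
  qed
  have "(\<Sum>k\<le>Suc r. c (Suc r - k) * (real k + \<beta>) * (F k - conf_mean X (Suc r) f)\<^sup>2) \<le>
    134 / (M + 1)\<^sup>2 * (\<Sum>k<Suc r. c (Suc r - Suc k) * (real k + 1 + \<beta>) *
      (real (Suc r - Suc k) + M)\<^sup>2 * (F (Suc k) - F k)\<^sup>2)"
  proof (rule weighted_hardy_polya_mean[OF M1 _ _ \<beta>0 \<beta>s])
    show "(real j + M) * c j = (real j + 1) * c (Suc j)" for j
      unfolding M_def c_def by (rule card_conf_Suc[OF Y(1)])
    show "c j > 0" for j unfolding c_def using card_conf_pos[OF Y] by simp
    show "(\<Sum>k\<le>Suc r. c (Suc r - k) * (F k - conf_mean X (Suc r) f)) = 0"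
      unfolding c_def F_def X by (rule sum_card_conf_mean_slices[OF Y x])
  qed
  also have "\<dots> \<le> 134 / (M + 1)\<^sup>2 * (\<Sum>k<Suc r. S * (\<Sum>\<zeta>\<in>conf Y (r - k). \<Sum>y\<in>Y.
      (real k + 1 + \<beta>) * (real (\<zeta> y) + 1) * (f (inc x (\<zeta>(x := k))) - f (inc y (\<zeta>(x := k))))\<^sup>2))"
    by (intro mult_left_mono sum_mono term_le) auto
  also have "(\<Sum>k<Suc r. S * (\<Sum>\<zeta>\<in>conf Y (r - k). \<Sum>y\<in>Y.
      (real k + 1 + \<beta>) * (real (\<zeta> y) + 1) * (f (inc x (\<zeta>(x := k))) - f (inc y (\<zeta>(x := k))))\<^sup>2)) =
      S * (\<Sum>k\<le>r. \<Sum>\<zeta>\<in>conf Y (r - k). \<Sum>y\<in>X. (real ((\<zeta>(x := k)) x) + 1 + \<beta>) *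
        (real ((\<zeta>(x := k)) y) + 1) * (f (inc x (\<zeta>(x := k))) - f (inc y (\<zeta>(x := k))))\<^sup>2)"
  proof -
    \<comment> \<open>The term \<open>y = x\<close> has zero gradient, so the sum extends from
      \<open>Y\<close> to \<open>X\<close>.\<close>
    have "(\<Sum>y\<in>Y. (real k + 1 + \<beta>) * (real (\<zeta> y) + 1) * (f (inc x (\<zeta>(x := k))) - f (inc y (\<zeta>(x := k))))\<^sup>2) =
      (\<Sum>y\<in>X. (real ((\<zeta>(x := k)) x) + 1 + \<beta>) *
        (real ((\<zeta>(x := k)) y) + 1) * (f (inc x (\<zeta>(x := k))) - f (inc y (\<zeta>(x := k))))\<^sup>2)" for k \<zeta>
      unfolding X sum.insert[OF Y(1) x] using x by (auto intro!: sum.cong)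
    then show ?thesis by (simp add: sum_distrib_left lessThan_Suc_atMost)
  qed
  also have "\<dots> = S * (\<Sum>\<xi>\<in>conf X r. \<Sum>y\<in>X. (real (\<xi> x) + 1 + \<beta>) * (real (\<xi> y) + 1) *
      (f (inc x \<xi>) - f (inc y \<xi>))\<^sup>2)"
    unfolding X by (subst sum_conf_insert[OF Y(1) x]) (rule refl)
  finally show ?thesis by (simp add: c_def F_def \<beta>_def mM add_ac)
qed

section \<open>Revealing a random site\<close>

text \<open>The numbers \<open>\<eta> x + 1\<close> add up to \<open>S\<close> and the uniform parts
  to \<open>3 * S\<close>, so \<open>p (\<eta> x)\<close> is a probability on the sites. Inserting
  this partition of unity and slicing at the chosen site yields the law of total variance.\<close>

lemma conf_var_decomposition:
  fixes f :: "('a \<Rightarrow> nat) \<Rightarrow> real"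
  assumes X: "finite X" "2 \<le> card X" and m: "m = real (card X)" and S: "S = m + real (Suc r)"
    and p: "\<And>k. p k = (real k + 1 + 3 * S / m) / (4 * S)"
  shows "conf_var X (Suc r) f = (\<Sum>x\<in>X. \<Sum>k\<le>Suc r. p k *
    (conf_var (X - {x}) (Suc r - k) (\<lambda>\<zeta>. f (\<zeta>(x := k))) + real (card (conf (X - {x}) (Suc r - k))) *
      (conf_mean (X - {x}) (Suc r - k) (\<lambda>\<zeta>. f (\<zeta>(x := k))) - conf_mean X (Suc r) f)\<^sup>2))"
proof -
  let ?\<mu> = "conf_mean X (Suc r) f"
  have mpos: "m > 0" and Spos: "S > 0" using X m S by auto
  have p1: "(\<Sum>x\<in>X. p (\<eta> x)) = 1" if "\<eta> \<in> conf X (Suc r)" for \<eta>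
  proof -
    have "(\<Sum>x\<in>X. p (\<eta> x)) = ((\<Sum>x\<in>X. real (\<eta> x) + 1) + 3 * S) / (4 * S)"
      unfolding p sum_divide_distrib[symmetric] using mpos by (simp add: sum.distrib m)
    also have "(\<Sum>x\<in>X. real (\<eta> x) + 1) = S"
      using sum_conf_shift[OF that] by (simp add: S m)
    finally show ?thesis using Spos by simp
  qed
  have "conf_var X (Suc r) f = (\<Sum>\<eta>\<in>conf X (Suc r). (\<Sum>x\<in>X. p (\<eta> x)) * (f \<eta> - ?\<mu>)\<^sup>2)"
    unfolding conf_var_def by (intro sum.cong refl) (simp add: p1)
  also have "\<dots> = (\<Sum>x\<in>X. \<Sum>\<eta>\<in>conf X (Suc r). p (\<eta> x) * (f \<eta> - ?\<mu>)\<^sup>2)"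
    unfolding sum_distrib_right by (rule sum.swap)
  also have "\<dots> = (\<Sum>x\<in>X. \<Sum>k\<le>Suc r. p k *
    (conf_var (X - {x}) (Suc r - k) (\<lambda>\<zeta>. f (\<zeta>(x := k))) + real (card (conf (X - {x}) (Suc r - k))) *
      (conf_mean (X - {x}) (Suc r - k) (\<lambda>\<zeta>. f (\<zeta>(x := k))) - ?\<mu>)\<^sup>2))"
  proof (rule sum.cong[OF refl])
    fix x assume x: "x \<in> X"
    define Y where "Y = X - {x}"
    have Y: "finite Y" "x \<notin> Y" "X = insert x Y" using X x by (auto simp: Y_def)
    have "Y \<noteq> {}" using X x by (auto simp: Y)
    note eq = sum_sq_shift_conf_mean[OF Y(1) this]
    have "(\<Sum>\<eta>\<in>conf X (Suc r). p (\<eta> x) * (f \<eta> - ?\<mu>)\<^sup>2) =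
        (\<Sum>k\<le>Suc r. \<Sum>\<zeta>\<in>conf Y (Suc r - k). p ((\<zeta>(x := k)) x) * (f (\<zeta>(x := k)) - ?\<mu>)\<^sup>2)"
      unfolding Y(3) by (rule sum_conf_insert[OF Y(1,2)])
    also have "\<dots> = (\<Sum>k\<le>Suc r. p k * (\<Sum>\<zeta>\<in>conf Y (Suc r - k). (f (\<zeta>(x := k)) - ?\<mu>)\<^sup>2))"
      by (simp add: sum_distrib_left)
    finally show "(\<Sum>\<eta>\<in>conf X (Suc r). p (\<eta> x) * (f \<eta> - ?\<mu>)\<^sup>2) = (\<Sum>k\<le>Suc r. p k *
      (conf_var (X - {x}) (Suc r - k) (\<lambda>\<zeta>. f (\<zeta>(x := k))) + real (card (conf (X - {x}) (Suc r - k))) *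
      (conf_mean (X - {x}) (Suc r - k) (\<lambda>\<zeta>. f (\<zeta>(x := k))) - ?\<mu>)\<^sup>2))"
      unfolding eq Y_def[symmetric] .
  qed
  finally show ?thesis .
qed

text \<open>
  The term \<open>1 - 3 / m\<close> pays for replacing \<open>(m - 1)\<^sup>3\<close> by \<open>m\<^sup>3\<close>; the term \<open>S (t y + t z) / 8\<close> is
  the gain from the size-biased choice.
\<close>

lemma removal_gain:
  fixes t :: "'i \<Rightarrow> real"
  assumes X: "finite X" "y \<in> X" "z \<in> X" "y \<noteq> z" and m: "m = real (card X)" "m \<ge> 12"
    and t: "\<And>x. x \<in> X \<Longrightarrow> 0 \<le> t x" "(\<Sum>x\<in>X. t x) \<le> S" and S: "S > 0"
  shows "(\<Sum>x\<in>X - {y, z}. (t x + 3 * S / m) / (4 * S) * (S - t x)\<^sup>2) \<le>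
    S\<^sup>2 * (1 - 3 / m) - S * (t y + t z) / 8"
proof -
  let ?Z = "X - {y, z}"
  have tS: "t x \<le> S" if "x \<in> X" for x
    using member_le_sum[of x X t] X t that by force
  have cardZ: "real (card ?Z) = m - 2"
  proof -
    have "card ?Z = card X - 2" using X by (simp add: card_Diff_subset)
    moreover have "card X \<ge> 2" using m by linarith
    ultimately show ?thesis using m by simp
  qed
  have sumZ: "(\<Sum>x\<in>?Z. t x) \<le> S - (t y + t z)"
  proof -
    have "(\<Sum>x\<in>X. t x) = (\<Sum>x\<in>?Z. t x) + (\<Sum>x\<in>{y, z}. t x)"
      using X by (intro sum.subset_diff) auto
    then show ?thesis using X t by simp
  qed
  have "(\<Sum>x\<in>?Z. (t x + 3 * S / m) / (4 * S) * (S - t x)\<^sup>2) \<le>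
      (\<Sum>x\<in>?Z. 3 * S\<^sup>2 / (4 * m) + S * (1 / 4 - 3 / (2 * m)) * t x)"
  proof (rule sum_mono)
    fix x assume x: "x \<in> ?Z"
    define q where "q = t x / S"
    have q: "0 \<le> q" "q \<le> 1" and tq: "t x = S * q" using x t tS S by (auto simp: q_def)
    define u where "u = 3 / m"
    \<comment> \<open>The aim is an upper bound linear in \<open>q\<close>, so that only the total
      of \<open>t\<close> matters afterwards. With \<open>0 \<le> q \<le> 1\<close> and
      \<open>u \<le> 1\<close> the terms of higher order have the right sign.\<close>
    have "u * q\<^sup>2 \<le> 1 * q\<^sup>2" using m by (intro mult_right_mono) (auto simp: u_def)
    also have "\<dots> \<le> 2 * q\<^sup>2 - q ^ 3"
      using mult_right_mono[OF q(2), of "q\<^sup>2"] by (simp add: power2_eq_square power3_eq_cube)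
    finally have "(q + u) * (1 - q)\<^sup>2 \<le> u + q - 2 * (u * q)"
      by (simp add: power2_eq_square power3_eq_cube algebra_simps)
    then have "(q + u) * (1 - q)\<^sup>2 / 4 \<le> (u + q - 2 * (u * q)) / 4" by simp
    also have "\<dots> = u / 4 + (1 / 4 - u / 2) * q" by (simp add: field_simps)
    finally have "(q + 3 / m) / 4 * (1 - q)\<^sup>2 \<le> 3 / (4 * m) + (1 / 4 - 3 / (2 * m)) * q"
      by (simp add: u_def mult.commute)
    then have "S\<^sup>2 * ((q + 3 / m) / 4 * (1 - q)\<^sup>2) \<le> S\<^sup>2 * (3 / (4 * m) + (1 / 4 - 3 / (2 * m)) * q)"
      by (intro mult_left_mono) auto
    moreover have "(t x + 3 * S / m) / (4 * S) * (S - t x)\<^sup>2 = S\<^sup>2 * ((q + 3 / m) / 4 * (1 - q)\<^sup>2)"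
    proof -
      have e1: "(t x + 3 * S / m) / (4 * S) = (q + 3 / m) / 4"
        using S by (simp add: tq field_simps)
      have e2: "(S - t x)\<^sup>2 = S\<^sup>2 * (1 - q)\<^sup>2"
        unfolding tq power_mult_distrib[symmetric] by (simp add: algebra_simps)
      show ?thesis unfolding e1 e2 by (simp only: mult_ac)
    qed
    moreover have "S\<^sup>2 * (3 / (4 * m) + (1 / 4 - 3 / (2 * m)) * q) =
        3 * S\<^sup>2 / (4 * m) + S * (1 / 4 - 3 / (2 * m)) * t x"
      by (simp add: tq power2_eq_square algebra_simps)
    ultimately show "(t x + 3 * S / m) / (4 * S) * (S - t x)\<^sup>2 \<le>
        3 * S\<^sup>2 / (4 * m) + S * (1 / 4 - 3 / (2 * m)) * t x" by linarith
  qed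
  also have "\<dots> = (m - 2) * (3 * S\<^sup>2 / (4 * m)) + S * (1 / 4 - 3 / (2 * m)) * (\<Sum>x\<in>?Z. t x)"
    by (simp add: sum.distrib cardZ sum_distrib_left)
  also have "\<dots> \<le> (m - 2) * (3 * S\<^sup>2 / (4 * m)) + S * (1 / 4 - 3 / (2 * m)) * (S - (t y + t z))"
    using m S by (intro add_left_mono mult_left_mono sumZ) (auto simp: field_simps)
  \<comment> \<open>The constant part gives \<open>3/4 - 3/(2 m)\<close> and the linear part
    \<open>1/4 - 3/(2 m)\<close>, together \<open>1 - 3/m\<close>.\<close>
  also have "\<dots> = S\<^sup>2 * (1 - 3 / m) - S * (t y + t z) * (1 / 4 - 3 / (2 * m))"
    using m by (simp add: field_simps power2_eq_square)
  \<comment> \<open>Here \<open>m \<ge> 12\<close> enters: it is exactly what makes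
    \<open>1/4 - 3/(2 m) \<ge> 1/8\<close>.\<close>
  also have "\<dots> \<le> S\<^sup>2 * (1 - 3 / m) - S * (t y + t z) * (1 / 8)"
    using m S t X by (intro diff_left_mono mult_left_mono) (auto simp: field_simps)
  finally show ?thesis by simp
qed

text \<open>The crude version for few sites: each square is at most \<open>S\<^sup>2\<close> and the
  weights sum to at most 1.\<close>

lemma removal_bound:
  fixes t :: "'i \<Rightarrow> real"
  assumes X: "finite X" "X \<noteq> {}" and m: "m = real (card X)"
    and t: "\<And>x. x \<in> X \<Longrightarrow> 0 \<le> t x" "(\<Sum>x\<in>X. t x) \<le> S" and S: "S > 0"
  shows "(\<Sum>x\<in>X - {y, z}. (t x + 3 * S / m) / (4 * S) * (S - t x)\<^sup>2) \<le> S\<^sup>2"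
proof -
  have mpos: "m > 0" using X m by (simp add: card_gt_0_iff)
  have tS: "t x \<le> S" if "x \<in> X" for x
    using member_le_sum[of x X t] X t that by force
  have "(\<Sum>x\<in>X - {y, z}. (t x + 3 * S / m) / (4 * S) * (S - t x)\<^sup>2) \<le>
      (\<Sum>x\<in>X - {y, z}. (t x + 3 * S / m) / (4 * S) * S\<^sup>2)"
    using t tS S mpos by (intro sum_mono mult_left_mono power_mono) auto
  also have "\<dots> \<le> (\<Sum>x\<in>X. (t x + 3 * S / m) / (4 * S) * S\<^sup>2)"
    using t S mpos X by (intro sum_mono2) auto
  also have "\<dots> = ((\<Sum>x\<in>X. t x) + 3 * S) / (4 * S) * S\<^sup>2"
    unfolding sum_distrib_right[symmetric] sum_divide_distrib[symmetric]
    using mpos by (simp add: sum.distrib m)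
  also have "\<dots> \<le> 1 * S\<^sup>2"
    using t S by (intro mult_right_mono) (auto simp: field_simps)
  finally show ?thesis by simp
qed

section \<open>Induction on the number of sites\<close>

text \<open>With density \<open>\<rho>\<close>, the factor \<open>S\<^sup>2 / m\<^sup>3\<close> is
  \<open>(\<rho> + 1)\<^sup>2 / m\<close>, and \<open>1 / m\<close> matches the jump rate on the
  complete graph. Arbitrary finite sets are allowed because the induction removes an arbitrary
  site.\<close>

definition conf_poincare :: "real \<Rightarrow> nat \<Rightarrow> bool" where
  "conf_poincare A m \<longleftrightarrow> (\<forall>(X :: nat set) r f. finite X \<longrightarrow> card X = m \<longrightarrow>
     conf_var X (Suc r) f \<le> A * (real m + real (Suc r))\<^sup>2 / real m ^ 3 * conf_energy X r f)"

lemma conf_poincare_mono: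
  assumes "conf_poincare A m" "A \<le> B"
  shows "conf_poincare B m"
  unfolding conf_poincare_def
proof (intro allI impI)
  fix X :: "nat set" and r f assume X: "finite X" "card X = m"
  have "conf_var X (Suc r) f \<le> A * (real m + real (Suc r))\<^sup>2 / real m ^ 3 * conf_energy X r f"
    using assms X by (simp add: conf_poincare_def)
  also have "\<dots> \<le> B * (real m + real (Suc r))\<^sup>2 / real m ^ 3 * conf_energy X r f"
    using assms(2) by (intro mult_right_mono divide_right_mono conf_energy_nonneg) auto
  finally show "conf_var X (Suc r) f \<le> B * (real m + real (Suc r))\<^sup>2 / real m ^ 3 * conf_energy X r f" .
qed

lemma conf_poincare_1: "conf_poincare 0 1"
  unfolding conf_poincare_def
proof (intro allI impI)
  fix X :: "nat set" and r and f :: "(nat \<Rightarrow> nat) \<Rightarrow> real" assume X: "finite X" "card X = 1"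
  then obtain a where a: "X = {a}" by (auto simp: card_1_singleton_iff)
  have "conf X (Suc r) = {(\<lambda>_. 0)(a := Suc r)}" by (auto simp: conf_def a fun_eq_iff)
  then show "conf_var X (Suc r) f \<le> 0 * (real 1 + real (Suc r))\<^sup>2 / real 1 ^ 3 * conf_energy X r f"
    by (simp add: conf_var_def conf_mean_def)
qed

text \<open>The induction hypothesis is applied off the revealed site \<open>x\<close>. It produces
  only gradients between sites other than \<open>x\<close>, so the gradient along
  \<open>y, z\<close> collects the contributions of all \<open>x\<close> outside
  \<open>{y, z}\<close>.\<close>

lemma removal_sum_le:
  fixes f :: "(nat \<Rightarrow> nat) \<Rightarrow> real"
  assumes IH: "conf_poincare A n" and A: "A \<ge> 0" and n: "n \<ge> 1"
    and X: "finite X" "card X = Suc n" and S: "S = real (Suc n) + real (Suc r)" and p: "\<And>k. p k \<ge> (0::real)"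
  shows "(\<Sum>x\<in>X. \<Sum>k\<le>Suc r. p k * conf_var (X - {x}) (Suc r - k) (\<lambda>\<zeta>. f (\<zeta>(x := k)))) \<le>
    A / real n ^ 3 * (\<Sum>\<xi>\<in>conf X r. \<Sum>y\<in>X. \<Sum>z\<in>X.
      (\<Sum>x\<in>X - {y, z}. p (\<xi> x) * (S - (real (\<xi> x) + 1))\<^sup>2) * (f (inc y \<xi>) - f (inc z \<xi>))\<^sup>2)"
proof -
  define d where "d \<xi> y z = (f (inc y \<xi>) - f (inc z \<xi>))\<^sup>2" for \<xi> y z
  define \<phi> where "\<phi> k = p k * (S - (real k + 1))\<^sup>2" for k
  have "(\<Sum>k\<le>Suc r. p k * conf_var (X - {x}) (Suc r - k) (\<lambda>\<zeta>. f (\<zeta>(x := k)))) \<le>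
      A / real n ^ 3 * (\<Sum>\<xi>\<in>conf X r. \<Sum>y\<in>X - {x}. \<Sum>z\<in>X - {x}. \<phi> (\<xi> x) * d \<xi> y z)" if x: "x \<in> X" for x
  proof -
    define Y where "Y = X - {x}"
    have Y: "finite Y" "x \<notin> Y" "X = insert x Y" "card Y = n" using X x by (auto simp: Y_def)
    \<comment> \<open>For \<open>k = Suc r\<close> no particle is left on \<open>Y\<close>, so that
      variance is zero.\<close>
    have "(\<Sum>k\<le>Suc r. p k * conf_var Y (Suc r - k) (\<lambda>\<zeta>. f (\<zeta>(x := k)))) =
        (\<Sum>k\<le>r. p k * conf_var Y (Suc r - k) (\<lambda>\<zeta>. f (\<zeta>(x := k))))"
      using Y by (simp add: conf_var_0)
    also have "\<dots> \<le> (\<Sum>k\<le>r. A / real n ^ 3 * (\<phi> k * conf_energy Y (r - k) (\<lambda>\<zeta>. f (\<zeta>(x := k)))))"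
    proof (rule sum_mono)
      fix k assume k: "k \<in> {..r}"
      \<comment> \<open>Removing \<open>x\<close> with its \<open>k\<close> particles lowers sites
        plus particles from \<open>S\<close> to \<open>S - (k + 1)\<close>.\<close>
      then have e: "Suc r - k = Suc (r - k)" "real n + real (Suc (r - k)) = S - (real k + 1)"
        by (auto simp: S)
      have "conf_var Y (Suc (r - k)) (\<lambda>\<zeta>. f (\<zeta>(x := k))) \<le>
          A * (real n + real (Suc (r - k)))\<^sup>2 / real n ^ 3 * conf_energy Y (r - k) (\<lambda>\<zeta>. f (\<zeta>(x := k)))"
        using IH Y unfolding conf_poincare_def by blast
      then have "p k * conf_var Y (Suc r - k) (\<lambda>\<zeta>. f (\<zeta>(x := k))) \<le> p k *
          (A * (S - (real k + 1))\<^sup>2 / real n ^ 3 * conf_energy Y (r - k) (\<lambda>\<zeta>. f (\<zeta>(x := k))))"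
        unfolding e by (intro mult_left_mono p)
      then show "p k * conf_var Y (Suc r - k) (\<lambda>\<zeta>. f (\<zeta>(x := k))) \<le>
          A / real n ^ 3 * (\<phi> k * conf_energy Y (r - k) (\<lambda>\<zeta>. f (\<zeta>(x := k))))"
        by (simp add: \<phi>_def mult_ac)
    qed
    also have "\<dots> = A / real n ^ 3 * (\<Sum>k\<le>r. \<Sum>\<zeta>\<in>conf Y (r - k). \<Sum>y\<in>Y. \<Sum>z\<in>Y.
        \<phi> ((\<zeta>(x := k)) x) * d (\<zeta>(x := k)) y z)"
    proof -
      have "inc y (\<zeta>(x := k)) = (inc y \<zeta>)(x := k)" if "y \<in> Y" for y k and \<zeta> :: "nat \<Rightarrow> nat"
        using that Y by (auto simp: inc_def fun_eq_iff)
      then show ?thesis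
        by (simp add: conf_energy_def d_def sum_distrib_left cong: sum.cong)
    qed
    also have "\<dots> = A / real n ^ 3 * (\<Sum>\<xi>\<in>conf X r. \<Sum>y\<in>Y. \<Sum>z\<in>Y. \<phi> (\<xi> x) * d \<xi> y z)"
      unfolding Y(3) by (subst sum_conf_insert[OF Y(1,2)]) (rule refl)
    finally show ?thesis unfolding Y_def .
  qed
  then have "(\<Sum>x\<in>X. \<Sum>k\<le>Suc r. p k * conf_var (X - {x}) (Suc r - k) (\<lambda>\<zeta>. f (\<zeta>(x := k)))) \<le>
      (\<Sum>x\<in>X. A / real n ^ 3 * (\<Sum>\<xi>\<in>conf X r. \<Sum>y\<in>X - {x}. \<Sum>z\<in>X - {x}. \<phi> (\<xi> x) * d \<xi> y z))"
    by (rule sum_mono)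
  also have "\<dots> = A / real n ^ 3 * (\<Sum>\<xi>\<in>conf X r. \<Sum>x\<in>X. \<Sum>y\<in>X - {x}. \<Sum>z\<in>X - {x}. \<phi> (\<xi> x) * d \<xi> y z)"
    unfolding sum_distrib_left[symmetric] by (subst sum.swap) (rule refl)
  also have "(\<Sum>\<xi>\<in>conf X r. \<Sum>x\<in>X. \<Sum>y\<in>X - {x}. \<Sum>z\<in>X - {x}. \<phi> (\<xi> x) * d \<xi> y z) =
      (\<Sum>\<xi>\<in>conf X r. \<Sum>y\<in>X. \<Sum>z\<in>X. (\<Sum>x\<in>X - {y, z}. \<phi> (\<xi> x)) * d \<xi> y z)"
  proof (rule sum.cong[OF refl])
    fix \<xi>
    have "(\<Sum>x\<in>X. \<Sum>y\<in>X - {x}. \<Sum>z\<in>X - {x}. \<phi> (\<xi> x) * d \<xi> y z) =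
        (\<Sum>x\<in>X. \<Sum>y\<in>X. \<Sum>z\<in>X. if x \<noteq> y \<and> x \<noteq> z then \<phi> (\<xi> x) * d \<xi> y z else 0)"
    proof (rule sum.cong[OF refl])
      fix x assume "x \<in> X"
      have in1: "(\<Sum>y\<in>X - {x}. h y) = (\<Sum>y\<in>X. if x \<noteq> y then h y else 0)" for h :: "nat \<Rightarrow> real"
      proof -
        have "X - {x} = {y \<in> X. x \<noteq> y}" by auto
        then show ?thesis using X by (simp only: sum.inter_filter)
      qed
      show "(\<Sum>y\<in>X - {x}. \<Sum>z\<in>X - {x}. \<phi> (\<xi> x) * d \<xi> y z) =
        (\<Sum>y\<in>X. \<Sum>z\<in>X. if x \<noteq> y \<and> x \<noteq> z then \<phi> (\<xi> x) * d \<xi> y z else 0)"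
        unfolding in1 by (intro sum.cong refl) auto
    qed
    also have "\<dots> = (\<Sum>y\<in>X. \<Sum>z\<in>X. \<Sum>x\<in>X. if x \<noteq> y \<and> x \<noteq> z then \<phi> (\<xi> x) * d \<xi> y z else 0)"
      by (subst sum.swap, rule sum.cong[OF refl], rule sum.swap)
    also have "\<dots> = (\<Sum>y\<in>X. \<Sum>z\<in>X. (\<Sum>x\<in>X - {y, z}. \<phi> (\<xi> x)) * d \<xi> y z)"
    proof (intro sum.cong refl)
      fix y z
      have eq: "X - {y, z} = {x \<in> X. x \<noteq> y \<and> x \<noteq> z}" by auto
      show "(\<Sum>x\<in>X. if x \<noteq> y \<and> x \<noteq> z then \<phi> (\<xi> x) * d \<xi> y z else 0) =
          (\<Sum>x\<in>X - {y, z}. \<phi> (\<xi> x)) * d \<xi> y z"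
        unfolding sum_distrib_right eq using X by (simp only: sum.inter_filter)
    qed
    finally show "(\<Sum>x\<in>X. \<Sum>y\<in>X - {x}. \<Sum>z\<in>X - {x}. \<phi> (\<xi> x) * d \<xi> y z) =
      (\<Sum>y\<in>X. \<Sum>z\<in>X. (\<Sum>x\<in>X - {y, z}. \<phi> (\<xi> x)) * d \<xi> y z)" .
  qed
  finally show ?thesis unfolding \<phi>_def d_def .
qed

text \<open>The product weight is reduced to a linear one by \<open>sum_sq_diff_via_uniform\<close>,
  and the summand 1 is absorbed since \<open>t x \<ge> 1\<close>. The constant is
  \<open>2 * 4 + 3 = 11\<close>, halved because the symmetric weight \<open>t x + t y\<close> counts
  \<open>E\<close> twice.\<close>

lemma sum_weighted_sq_diff_le:
  fixes t g :: "'i \<Rightarrow> real"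
  assumes X: "finite X" "X \<noteq> {}" and m: "m = real (card X)"
    and t: "\<And>x. x \<in> X \<Longrightarrow> 1 \<le> t x" "(\<Sum>x\<in>X. t x) \<le> S"
  shows "(\<Sum>x\<in>X. \<Sum>y\<in>X. (t x + 1 + 3 * S / m) * t y * (g x - g y)\<^sup>2) \<le>
    11 * S / (2 * m) * (\<Sum>x\<in>X. \<Sum>y\<in>X. (t x + t y) * (g x - g y)\<^sup>2)"
proof -
  define E where "E = (\<Sum>x\<in>X. \<Sum>y\<in>X. t x * (g x - g y)\<^sup>2)"
  have mpos: "m > 0" using X m by (simp add: card_gt_0_iff)
  have t0: "t x \<ge> 0" if "x \<in> X" for x using t(1)[OF that] by simp
  have E0: "E \<ge> 0" unfolding E_def using t0 by (intro sum_nonneg mult_nonneg_nonneg) auto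
  have E': "(\<Sum>x\<in>X. \<Sum>y\<in>X. t y * (g x - g y)\<^sup>2) = E"
    unfolding E_def by (subst sum.swap) (simp add: power2_commute)
  have "m * (\<Sum>x\<in>X. \<Sum>y\<in>X. t x * t y * (g x - g y)\<^sup>2) \<le> 4 * (\<Sum>x\<in>X. t x) * E"
    unfolding m E_def by (rule sum_sq_diff_via_uniform[OF X(1) t0])
  also have "\<dots> \<le> 4 * S * E" using t(2) E0 by (intro mult_right_mono) auto
  finally have tt: "(\<Sum>x\<in>X. \<Sum>y\<in>X. t x * t y * (g x - g y)\<^sup>2) \<le> 4 * S * E / m"
    using mpos by (simp add: field_simps)
  have "(\<Sum>x\<in>X. \<Sum>y\<in>X. (t x + 1 + 3 * S / m) * t y * (g x - g y)\<^sup>2) \<le>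
      (\<Sum>x\<in>X. \<Sum>y\<in>X. 2 * (t x * t y * (g x - g y)\<^sup>2) + 3 * S / m * (t y * (g x - g y)\<^sup>2))"
  proof (intro sum_mono)
    fix x y assume xy: "x \<in> X" "y \<in> X"
    have "(t x + 1 + 3 * S / m) * (t y * (g x - g y)\<^sup>2) \<le> (2 * t x + 3 * S / m) * (t y * (g x - g y)\<^sup>2)"
      using t(1)[OF xy(1)] t0[OF xy(2)] by (intro mult_right_mono) auto
    then show "(t x + 1 + 3 * S / m) * t y * (g x - g y)\<^sup>2 \<le>
        2 * (t x * t y * (g x - g y)\<^sup>2) + 3 * S / m * (t y * (g x - g y)\<^sup>2)"
      by (simp add: algebra_simps)
  qed
  also have "\<dots> = 2 * (\<Sum>x\<in>X. \<Sum>y\<in>X. t x * t y * (g x - g y)\<^sup>2) +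
      3 * S / m * (\<Sum>x\<in>X. \<Sum>y\<in>X. t y * (g x - g y)\<^sup>2)"
    by (simp only: sum.distrib sum_distrib_left)
  also have "\<dots> \<le> 2 * (4 * S * E / m) + 3 * S / m * E"
    unfolding E' using tt by (intro add_right_mono mult_left_mono) auto
  also have "\<dots> = 11 * S / (2 * m) * (E + E)" by (simp add: field_simps)
  also have "E + E = (\<Sum>x\<in>X. \<Sum>y\<in>X. (t x + t y) * (g x - g y)\<^sup>2)"
    by (subst (2) E'[symmetric]) (simp add: E_def sum.distrib distrib_right)
  finally show ?thesis .
qed

text \<open>Bounds the second part of the variance decomposition by summing
  \<open>site_estimate\<close> over the revealed site; \<open>t x\<close> in
  \<open>sum_weighted_sq_diff_le\<close> is \<open>\<xi> x + 1\<close>.\<close>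

lemma site_sum_le:
  fixes f :: "('a \<Rightarrow> nat) \<Rightarrow> real"
  assumes X: "finite X" "2 \<le> card X" and m: "m = real (card X)" and S: "S = m + real (Suc r)"
    and p: "\<And>k. p k = (real k + 1 + 3 * S / m) / (4 * S)"
  shows "(\<Sum>x\<in>X. \<Sum>k\<le>Suc r. p k * (real (card (conf (X - {x}) (Suc r - k))) *
      (conf_mean (X - {x}) (Suc r - k) (\<lambda>\<zeta>. f (\<zeta>(x := k))) - conf_mean X (Suc r) f)\<^sup>2)) \<le>
    200 * S / m ^ 3 * (\<Sum>\<xi>\<in>conf X r. \<Sum>x\<in>X. \<Sum>y\<in>X. ((real (\<xi> x) + 1) + (real (\<xi> y) + 1)) *
      (f (inc x \<xi>) - f (inc y \<xi>))\<^sup>2)"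
proof -
  have mpos: "m > 0" and Spos: "S > 0" and Xne: "X \<noteq> {}" using X m S by auto
  define R where "R = (\<Sum>\<xi>\<in>conf X r. \<Sum>x\<in>X. \<Sum>y\<in>X. ((real (\<xi> x) + 1) + (real (\<xi> y) + 1)) *
      (f (inc x \<xi>) - f (inc y \<xi>))\<^sup>2)"
  have R0: "R \<ge> 0" unfolding R_def by (intro sum_nonneg) auto
  have "(\<Sum>k\<le>Suc r. p k * (real (card (conf (X - {x}) (Suc r - k))) *
      (conf_mean (X - {x}) (Suc r - k) (\<lambda>\<zeta>. f (\<zeta>(x := k))) - conf_mean X (Suc r) f)\<^sup>2)) \<le>
      1 / (4 * S) * (134 * S / m\<^sup>2 * (\<Sum>\<xi>\<in>conf X r. \<Sum>y\<in>X. (real (\<xi> x) + 2 + 3 * S / m) * (real (\<xi> y) + 1) *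
      (f (inc x \<xi>) - f (inc y \<xi>))\<^sup>2))" if x: "x \<in> X" for x
  proof -
    define Y where "Y = X - {x}"
    have Y: "finite Y" "x \<notin> Y" "X = insert x Y" using X x by (auto simp: Y_def)
    have "Y \<noteq> {}" using X x by (auto simp: Y)
    note Y = Y(1) this Y(2,3)
    have "(\<Sum>k\<le>Suc r. p k * (real (card (conf Y (Suc r - k))) *
        (conf_mean Y (Suc r - k) (\<lambda>\<zeta>. f (\<zeta>(x := k))) - conf_mean X (Suc r) f)\<^sup>2)) =
      1 / (4 * S) * (\<Sum>k\<le>Suc r. real (card (conf Y (Suc r - k))) * (real k + 1 + 3 * S / m) *
        (conf_mean Y (Suc r - k) (\<lambda>\<zeta>. f (\<zeta>(x := k))) - conf_mean X (Suc r) f)\<^sup>2)"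
      unfolding sum_distrib_left by (intro sum.cong refl) (simp add: p)
    also have "\<dots> \<le> 1 / (4 * S) * (134 * S / m\<^sup>2 * (\<Sum>\<xi>\<in>conf X r. \<Sum>y\<in>X.
        (real (\<xi> x) + 2 + 3 * S / m) * (real (\<xi> y) + 1) * (f (inc x \<xi>) - f (inc y \<xi>))\<^sup>2))"
      using Spos by (intro mult_left_mono site_estimate[OF Y m S]) auto
    finally show ?thesis unfolding Y_def .
  qed
  then have "(\<Sum>x\<in>X. \<Sum>k\<le>Suc r. p k * (real (card (conf (X - {x}) (Suc r - k))) *
      (conf_mean (X - {x}) (Suc r - k) (\<lambda>\<zeta>. f (\<zeta>(x := k))) - conf_mean X (Suc r) f)\<^sup>2)) \<le>
      (\<Sum>x\<in>X. 1 / (4 * S) * (134 * S / m\<^sup>2 * (\<Sum>\<xi>\<in>conf X r. \<Sum>y\<in>X.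
        (real (\<xi> x) + 2 + 3 * S / m) * (real (\<xi> y) + 1) * (f (inc x \<xi>) - f (inc y \<xi>))\<^sup>2)))"
    by (rule sum_mono)
  also have "\<dots> = 1 / (4 * S) * (134 * S / m\<^sup>2 * (\<Sum>\<xi>\<in>conf X r. \<Sum>x\<in>X. \<Sum>y\<in>X.
        (real (\<xi> x) + 2 + 3 * S / m) * (real (\<xi> y) + 1) * (f (inc x \<xi>) - f (inc y \<xi>))\<^sup>2))"
    unfolding sum_distrib_left[symmetric] by (subst sum.swap) (rule refl)
  also have "\<dots> \<le> 1 / (4 * S) * (134 * S / m\<^sup>2 * (\<Sum>\<xi>\<in>conf X r. 11 * S / (2 * m) *
      (\<Sum>x\<in>X. \<Sum>y\<in>X. ((real (\<xi> x) + 1) + (real (\<xi> y) + 1)) * (f (inc x \<xi>) - f (inc y \<xi>))\<^sup>2)))"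
  proof (intro mult_left_mono sum_mono)
    fix \<xi> assume "\<xi> \<in> conf X r"
    then have "(\<Sum>x\<in>X. real (\<xi> x) + 1) \<le> S" using sum_conf_shift[of \<xi> X r] by (simp add: S m)
    then have "(\<Sum>x\<in>X. \<Sum>y\<in>X. ((real (\<xi> x) + 1) + 1 + 3 * S / m) * (real (\<xi> y) + 1) * (f (inc x \<xi>) - f (inc y \<xi>))\<^sup>2) \<le>
      11 * S / (2 * m) * (\<Sum>x\<in>X. \<Sum>y\<in>X. ((real (\<xi> x) + 1) + (real (\<xi> y) + 1)) * (f (inc x \<xi>) - f (inc y \<xi>))\<^sup>2)"
      by (intro sum_weighted_sq_diff_le[OF X(1) Xne m]) auto
    then show "(\<Sum>x\<in>X. \<Sum>y\<in>X. (real (\<xi> x) + 2 + 3 * S / m) * (real (\<xi> y) + 1) * (f (inc x \<xi>) - f (inc y \<xi>))\<^sup>2) \<le>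
      11 * S / (2 * m) * (\<Sum>x\<in>X. \<Sum>y\<in>X. ((real (\<xi> x) + 1) + (real (\<xi> y) + 1)) * (f (inc x \<xi>) - f (inc y \<xi>))\<^sup>2)"
      by (simp add: add.assoc)
  qed (use Spos in auto)
  \<comment> \<open>The constant is \<open>134 / 4 * 11 / 2\<close>.\<close>
  also have "\<dots> = 737 / 4 * (S / m ^ 3 * R)"
    unfolding R_def sum_distrib_left[symmetric] using mpos Spos
    by (simp add: power2_eq_square power3_eq_cube)
  also have "\<dots> \<le> 200 * (S / m ^ 3 * R)"
    using mpos Spos R0 by (intro mult_right_mono) auto
  finally show ?thesis by (simp add: R_def)
qed

text \<open>Both parts of the variance are sums of squared gradients, so it suffices to compare
  coefficients for each pair \<open>y, z\<close>. The premise \<open>bound\<close> is this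
  comparison, with \<open>t x\<close> in the role of \<open>\<xi> x + 1\<close>; pairs with
  \<open>y = z\<close> have zero gradient and are left out.\<close>

lemma conf_var_step:
  fixes f :: "(nat \<Rightarrow> nat) \<Rightarrow> real"
  assumes IH: "conf_poincare A n" and A: "A \<ge> 0" and n: "n \<ge> 1"
    and X: "finite X" "card X = Suc n" and m: "m = real (Suc n)" and S: "S = m + real (Suc r)"
    and bound: "\<And>t y z. (\<And>x. x \<in> X \<Longrightarrow> 1 \<le> t x) \<Longrightarrow> (\<Sum>x\<in>X. t x) \<le> S \<Longrightarrow> y \<in> X \<Longrightarrow> z \<in> X \<Longrightarrow> y \<noteq> z \<Longrightarrow>
      A / real n ^ 3 * (\<Sum>x\<in>X - {y, z}. (t x + 3 * S / m) / (4 * S) * (S - t x)\<^sup>2) +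
      200 * S / m ^ 3 * (t y + t z) \<le> B * S\<^sup>2 / m ^ 3"
  shows "conf_var X (Suc r) f \<le> B * S\<^sup>2 / m ^ 3 * conf_energy X r f"
proof -
  define p where "p k = (real k + 1 + 3 * S / m) / (4 * S)" for k
  have cX: "2 \<le> card X" "m = real (card X)" using X n m by auto
  have p0: "p k \<ge> 0" for k unfolding p_def using m S by auto
  have lin: "a * (\<Sum>\<xi>\<in>P. \<Sum>y\<in>X. \<Sum>z\<in>X. G \<xi> y z * d \<xi> y z) + b * (\<Sum>\<xi>\<in>P. \<Sum>y\<in>X. \<Sum>z\<in>X. H \<xi> y z * d \<xi> y z) =
      (\<Sum>\<xi>\<in>P. \<Sum>y\<in>X. \<Sum>z\<in>X. (a * G \<xi> y z + b * H \<xi> y z) * d \<xi> y z)"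
    for a b :: real and G H d :: "(nat \<Rightarrow> nat) \<Rightarrow> nat \<Rightarrow> nat \<Rightarrow> real" and P
    by (simp add: sum_distrib_left sum.distrib distrib_right mult.assoc)
  have "conf_var X (Suc r) f = (\<Sum>x\<in>X. \<Sum>k\<le>Suc r. p k * conf_var (X - {x}) (Suc r - k) (\<lambda>\<zeta>. f (\<zeta>(x := k)))) +
    (\<Sum>x\<in>X. \<Sum>k\<le>Suc r. p k * (real (card (conf (X - {x}) (Suc r - k))) *
      (conf_mean (X - {x}) (Suc r - k) (\<lambda>\<zeta>. f (\<zeta>(x := k))) - conf_mean X (Suc r) f)\<^sup>2))"
    unfolding conf_var_decomposition[OF X(1) cX S p_def] distrib_left sum.distrib ..
  also have "\<dots> \<le> A / real n ^ 3 * (\<Sum>\<xi>\<in>conf X r. \<Sum>y\<in>X. \<Sum>z\<in>X.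
      (\<Sum>x\<in>X - {y, z}. p (\<xi> x) * (S - (real (\<xi> x) + 1))\<^sup>2) * (f (inc y \<xi>) - f (inc z \<xi>))\<^sup>2) +
    200 * S / m ^ 3 * (\<Sum>\<xi>\<in>conf X r. \<Sum>x\<in>X. \<Sum>y\<in>X. ((real (\<xi> x) + 1) + (real (\<xi> y) + 1)) *
      (f (inc x \<xi>) - f (inc y \<xi>))\<^sup>2)"
    by (intro add_mono removal_sum_le[OF IH A n X S[unfolded m] p0] site_sum_le[OF X(1) cX S p_def])
  also have "\<dots> = (\<Sum>\<xi>\<in>conf X r. \<Sum>y\<in>X. \<Sum>z\<in>X. (A / real n ^ 3 *
      (\<Sum>x\<in>X - {y, z}. p (\<xi> x) * (S - (real (\<xi> x) + 1))\<^sup>2) +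
      200 * S / m ^ 3 * ((real (\<xi> y) + 1) + (real (\<xi> z) + 1))) * (f (inc y \<xi>) - f (inc z \<xi>))\<^sup>2)"
    by (rule lin)
  also have "\<dots> \<le> (\<Sum>\<xi>\<in>conf X r. \<Sum>y\<in>X. \<Sum>z\<in>X. B * S\<^sup>2 / m ^ 3 * (f (inc y \<xi>) - f (inc z \<xi>))\<^sup>2)"
  proof (intro sum_mono)
    fix \<xi> y z assume \<xi>: "\<xi> \<in> conf X r" and yz: "y \<in> X" "z \<in> X"
    show "(A / real n ^ 3 * (\<Sum>x\<in>X - {y, z}. p (\<xi> x) * (S - (real (\<xi> x) + 1))\<^sup>2) +
      200 * S / m ^ 3 * ((real (\<xi> y) + 1) + (real (\<xi> z) + 1))) * (f (inc y \<xi>) - f (inc z \<xi>))\<^sup>2 \<le>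
      B * S\<^sup>2 / m ^ 3 * (f (inc y \<xi>) - f (inc z \<xi>))\<^sup>2"
    proof (cases "y = z")
      case False
      have "(\<Sum>x\<in>X. real (\<xi> x) + 1) \<le> S" using sum_conf_shift[OF \<xi>] by (simp add: S cX)
      then show ?thesis unfolding p_def using False yz
        by (intro mult_right_mono bound) auto
    qed simp
  qed
  also have "\<dots> = B * S\<^sup>2 / m ^ 3 * conf_energy X r f"
    by (simp add: conf_energy_def sum_distrib_left)
  finally show ?thesis .
qed

text \<open>No gain is exploited, so the constant grows: the 8 comes from
  \<open>n + 1 \<le> 2 * n\<close>, the 200 from \<open>t y + t z \<le> S\<close>. This is harmless
  for a bounded number of steps.\<close>

lemma conf_poincare_Suc_small:
  assumes IH: "conf_poincare A n" and A: "A \<ge> 0" and n: "n \<ge> 1"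
  shows "conf_poincare (8 * A + 200) (Suc n)"
  unfolding conf_poincare_def
proof (intro allI impI)
  fix X :: "nat set" and r and f :: "(nat \<Rightarrow> nat) \<Rightarrow> real" assume X: "finite X" "card X = Suc n"
  define m S where "m = real (Suc n)" and "S = m + real (Suc r)"
  have mpos: "m > 0" and Spos: "S > 0" by (auto simp: m_def S_def)
  show "conf_var X (Suc r) f \<le> (8 * A + 200) * (real (Suc n) + real (Suc r))\<^sup>2 / real (Suc n) ^ 3 * conf_energy X r f"
    unfolding m_def[symmetric] S_def[symmetric]
  proof (rule conf_var_step[OF IH A n X m_def S_def])
    fix t y z assume t: "\<And>x. x \<in> X \<Longrightarrow> 1 \<le> t x" "(\<Sum>x\<in>X. t x) \<le> S" and yz: "y \<in> X" "z \<in> X" "y \<noteq> z"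
    have t0: "t x \<ge> 0" if "x \<in> X" for x using t(1)[OF that] by simp
    let ?G = "\<Sum>x\<in>X - {y, z}. (t x + 3 * S / m) / (4 * S) * (S - t x)\<^sup>2"
    have "?G \<le> S\<^sup>2"
      using X yz t0 t Spos by (intro removal_bound) (auto simp: m_def)
    then have "A / real n ^ 3 * ?G \<le> A / real n ^ 3 * S\<^sup>2"
      using A by (intro mult_left_mono) auto
    also have "\<dots> \<le> 8 * A / m ^ 3 * S\<^sup>2"
    proof (rule mult_right_mono)
      have "m ^ 3 \<le> (2 * real n) ^ 3" using n by (intro power_mono) (auto simp: m_def)
      then have "A * m ^ 3 \<le> A * (8 * real n ^ 3)" using A
        by (intro mult_left_mono) (auto simp: power_mult_distrib)
      then show "A / real n ^ 3 \<le> 8 * A / m ^ 3" using n mpos by (simp add: divide_simps mult_ac)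
    qed simp
    finally have 1: "A / real n ^ 3 * ?G \<le> 8 * A / m ^ 3 * S\<^sup>2" .
    have "t y + t z = (\<Sum>x\<in>{y, z}. t x)" using yz by simp
    also have "\<dots> \<le> (\<Sum>x\<in>X. t x)" using X yz t0 by (intro sum_mono2) auto
    also note t(2)
    finally have "200 * S / m ^ 3 * (t y + t z) \<le> 200 * S / m ^ 3 * S"
      using mpos Spos by (intro mult_left_mono) auto
    with 1 have "A / real n ^ 3 * ?G + 200 * S / m ^ 3 * (t y + t z) \<le> 8 * A / m ^ 3 * S\<^sup>2 + 200 * S / m ^ 3 * S"
      by (rule add_mono)
    also have "\<dots> = (8 * A + 200) * S\<^sup>2 / m ^ 3"
      by (simp add: power2_eq_square add_divide_distrib distrib_right)
    finally show "A / real n ^ 3 * ?G + 200 * S / m ^ 3 * (t y + t z) \<le> (8 * A + 200) * S\<^sup>2 / m ^ 3" .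
  qed
qed

text \<open>The constant does not grow. The threshold 1600 is \<open>8 * 200\<close>: the gain
  \<open>A * S * T / 8\<close> then covers the gradient weight \<open>200 * S * T\<close>. The bound
  \<open>n \<ge> 11\<close> provides \<open>m \<ge> 12\<close> for
  \<open>removal_gain\<close>.\<close>

lemma conf_poincare_Suc_large:
  assumes IH: "conf_poincare A n" and A: "A \<ge> 1600" and n: "n \<ge> 11"
  shows "conf_poincare A (Suc n)"
  unfolding conf_poincare_def
proof (intro allI impI)
  fix X :: "nat set" and r and f :: "(nat \<Rightarrow> nat) \<Rightarrow> real" assume X: "finite X" "card X = Suc n"
  define m S where "m = real (Suc n)" and "S = m + real (Suc r)"
  have mpos: "m > 0" and Spos: "S > 0" by (auto simp: m_def S_def)
  have A0: "A \<ge> 0" and n1: "n \<ge> 1" using A n by auto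
  show "conf_var X (Suc r) f \<le> A * (real (Suc n) + real (Suc r))\<^sup>2 / real (Suc n) ^ 3 * conf_energy X r f"
    unfolding m_def[symmetric] S_def[symmetric]
  proof (rule conf_var_step[OF IH A0 n1 X m_def S_def])
    fix t y z assume t: "\<And>x. x \<in> X \<Longrightarrow> 1 \<le> t x" "(\<Sum>x\<in>X. t x) \<le> S" and yz: "y \<in> X" "z \<in> X" "y \<noteq> z"
    have t0: "t x \<ge> 0" if "x \<in> X" for x using t(1)[OF that] by simp
    let ?G = "\<Sum>x\<in>X - {y, z}. (t x + 3 * S / m) / (4 * S) * (S - t x)\<^sup>2"
    define T where "T = t y + t z"
    define N where "N = real n ^ 3"
    have T0: "T \<ge> 0" using t0 yz by (simp add: T_def)
    have N0: "N > 0" using n by (simp add: N_def)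
    have nm: "real n = m - 1" by (simp add: m_def)
    have mN: "(1 - 3 / m) / N \<le> 1 / m ^ 3" "1 / m ^ 3 \<le> 1 / N"
    proof -
      have "(1 - 3 / m) * m ^ 3 = m ^ 3 - 3 * m\<^sup>2"
        using mpos by (simp add: field_simps power2_eq_square power3_eq_cube)
      \<comment> \<open>Expanding,
        \<open>(m - 1)\<^sup>3 = m\<^sup>3 - 3 m\<^sup>2 + (3 m - 1)\<close>, and the last bracket
        is positive.\<close>
      also have "\<dots> \<le> N" using n unfolding N_def nm
        by (simp add: power2_eq_square power3_eq_cube algebra_simps m_def)
      finally show "(1 - 3 / m) / N \<le> 1 / m ^ 3" using N0 mpos by (simp add: divide_simps mult_ac)
      have "N \<le> m ^ 3" unfolding N_def m_def by (intro power_mono) auto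
      then show "1 / m ^ 3 \<le> 1 / N" using N0 by (simp add: frac_le)
    qed
    have "?G \<le> S\<^sup>2 * (1 - 3 / m) - S * T / 8"
      unfolding T_def using X yz t0 t Spos n by (intro removal_gain) (auto simp: m_def)
    then have "A / N * ?G \<le> A / N * (S\<^sup>2 * (1 - 3 / m) - S * T / 8)"
      using A N0 by (intro mult_left_mono) auto
    also have "\<dots> = A * S\<^sup>2 * ((1 - 3 / m) / N) - A / 8 * S * T * (1 / N)"
      by (simp add: diff_divide_distrib right_diff_distrib mult_ac)
    also have "\<dots> \<le> A * S\<^sup>2 * (1 / m ^ 3) - 200 * S * T * (1 / m ^ 3)"
      using A Spos T0 mpos by (intro diff_mono mult_left_mono mult_mono mN) auto
    finally show "A / real n ^ 3 * ?G + 200 * S / m ^ 3 * (t y + t z) \<le> A * S\<^sup>2 / m ^ 3"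
      by (simp add: N_def T_def)
  qed
qed

text \<open>The growing step is used up to 11 sites, the stable step from there on. The requirement
  \<open>A \<ge> 1600\<close> is carried through the first phase so that its final constant is
  admissible in the second.\<close>

lemma conf_poincare_uniform: "\<exists>A>0. \<forall>m\<ge>1. conf_poincare A m"
proof -
  have small: "\<exists>A\<ge>1600. \<forall>j\<in>{1..m}. conf_poincare A j" for m
  proof (induction m)
    case (Suc m)
    then obtain A where A: "A \<ge> 1600" "\<forall>j\<in>{1..m}. conf_poincare A j"
      by (elim exE conjE) (rule that)
    have step: "conf_poincare (8 * A + 200) j" if "j \<in> {1..Suc m}" for j
    proof (cases "j \<le> m")
      case True
      then have "conf_poincare A j" using that A by simp
      then show ?thesis by (rule conf_poincare_mono) (use A in simp)
    next
      case False
      then have j: "j = Suc m" using that by simp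
      show ?thesis
      proof (cases m)
        case 0
        have "conf_poincare (8 * A + 200) 1"
          using conf_poincare_1 by (rule conf_poincare_mono) (use A in simp)
        then show ?thesis using j 0 by simp
      next
        case (Suc m')
        then show ?thesis using A unfolding j by (intro conf_poincare_Suc_small[of A]) auto
      qed
    qed
    have "8 * A + 200 \<ge> 1600" using A by simp
    then show ?case by (intro exI[of _ "8 * A + 200"] conjI ballI step)
  qed (auto intro: exI[of _ 1600])
  obtain A where A: "A \<ge> 1600" "\<forall>j\<in>{1..11}. conf_poincare A j"
    using small[of 11] by (elim exE conjE) (rule that)
  have large: "conf_poincare A (11 + k)" for k
  proof (induction k)
    case (Suc k)
    show ?case using conf_poincare_Suc_large[OF Suc A(1)] by simp
  qed (use A in simp)
  have "conf_poincare A m" if "m \<ge> 1" for m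
  proof (cases "m \<le> 11")
    case False
    then show ?thesis using large[of "m - 11"] by simp
  qed (use A that in auto)
  then show ?thesis using A by (intro exI[of _ A]) auto
qed

section \<open>Translation to the zero range process\<close>

lemma zrp_states_eq_conf: "zrp_states n r = conf {..<n} r"
  by (auto simp: zrp_states_def conf_def)

lemma zrp_var_eq: "zrp_var n r f = conf_var {..<n} r f / real (card (conf {..<n} r))"
proof -
  have "zrp_mean n r f = conf_mean {..<n} r f"
    by (simp add: zrp_mean_def conf_mean_def zrp_pi_def zrp_states_eq_conf sum_divide_distrib)
  then show ?thesis
    by (simp add: zrp_var_def conf_var_def zrp_pi_def zrp_states_eq_conf sum_divide_distrib)
qed

lemma zrp_move_in_conf:
  assumes "\<eta> \<in> conf {..<n} s" "x < n" "y < n" "x \<noteq> y" "1 \<le> \<eta> x"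
  shows "zrp_move \<eta> x y \<in> conf {..<n} s"
proof -
  let ?\<eta> = "zrp_move \<eta> x y"
  have "sum h {..<n} = h x + (h y + sum h ({..<n} - {x} - {y}))" for h :: "nat \<Rightarrow> nat"
    using assms by (simp add: sum.remove[of _ x] sum.remove[of _ y])
  moreover have "sum ?\<eta> ({..<n} - {x} - {y}) = sum \<eta> ({..<n} - {x} - {y})"
    by (intro sum.cong) (auto simp: zrp_move_def)
  moreover have "?\<eta> x = \<eta> x - 1" "?\<eta> y = \<eta> y + 1" using assms by (auto simp: zrp_move_def)
  ultimately have "sum ?\<eta> {..<n} = sum \<eta> {..<n}" using assms by simp
  then show ?thesis using assms by (auto simp: conf_def zrp_move_def)
qed

text \<open>Re-indexing jumps by the particles at rest turns the Dirichlet form into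
  \<open>conf_energy\<close>. The denominator collects the 1/2 of the form, the jump rate and the
  uniform weight.\<close>

lemma zrp_dirichlet_eq:
  "zrp_dirichlet n (Suc r) f =
    conf_energy {..<n} r f / (2 * real (n - 1) * real (card (conf {..<n} (Suc r))))"
proof -
  let ?X = "{..<n}" and ?\<Omega> = "conf {..<n} (Suc r)"
  define N where "N = real (card ?\<Omega>)"
  have fin: "finite ?\<Omega>" by (simp add: finite_conf)
  define h where "h x \<eta> = (\<Sum>y<n. if x \<noteq> y then (f \<eta> - f (zrp_move \<eta> x y))\<^sup>2 else 0)" for x \<eta>
  have inner: "(\<Sum>\<eta>'\<in>?\<Omega>. zrp_rate n \<eta> \<eta>' * (f \<eta> - f \<eta>')\<^sup>2) =
      (\<Sum>x<n. if 1 \<le> \<eta> x then h x \<eta> else 0) / real (n - 1)" if \<eta>: "\<eta> \<in> ?\<Omega>" for \<eta>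
  proof -
    have "(\<Sum>\<eta>'\<in>?\<Omega>. zrp_rate n \<eta> \<eta>' * (f \<eta> - f \<eta>')\<^sup>2) =
        (\<Sum>\<eta>'\<in>?\<Omega>. \<Sum>x<n. \<Sum>y<n. (if x \<noteq> y \<and> 1 \<le> \<eta> x \<and> zrp_move \<eta> x y = \<eta>'
          then 1 / real (n - 1) else 0) * (f \<eta> - f \<eta>')\<^sup>2)"
      by (simp add: zrp_rate_def sum_distrib_right)
    also have "\<dots> = (\<Sum>x<n. \<Sum>y<n. \<Sum>\<eta>'\<in>?\<Omega>. (if x \<noteq> y \<and> 1 \<le> \<eta> x \<and> zrp_move \<eta> x y = \<eta>'
          then 1 / real (n - 1) else 0) * (f \<eta> - f \<eta>')\<^sup>2)"
      by (subst sum.swap, rule sum.cong[OF refl], rule sum.swap)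
    also have "\<dots> = (\<Sum>x<n. \<Sum>y<n. if 1 \<le> \<eta> x \<and> x \<noteq> y then (f \<eta> - f (zrp_move \<eta> x y))\<^sup>2 / real (n - 1) else 0)"
    proof (intro sum.cong refl)
      fix x y assume xy: "x \<in> ?X" "y \<in> ?X"
      show "(\<Sum>\<eta>'\<in>?\<Omega>. (if x \<noteq> y \<and> 1 \<le> \<eta> x \<and> zrp_move \<eta> x y = \<eta>'
          then 1 / real (n - 1) else 0) * (f \<eta> - f \<eta>')\<^sup>2) =
          (if 1 \<le> \<eta> x \<and> x \<noteq> y then (f \<eta> - f (zrp_move \<eta> x y))\<^sup>2 / real (n - 1) else 0)"
      proof (cases "1 \<le> \<eta> x \<and> x \<noteq> y")
        case True
        \<comment> \<open>The target of the jump is a state, so the sum over targets has exactly one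
          nonvanishing indicator.\<close>
        then have "zrp_move \<eta> x y \<in> ?\<Omega>" using \<eta> xy by (intro zrp_move_in_conf) auto
        then show ?thesis using True fin by (simp add: if_distrib[of "\<lambda>u. u * _"] sum.delta' cong: if_cong)
      qed auto
    qed
    also have "\<dots> = (\<Sum>x<n. if 1 \<le> \<eta> x then h x \<eta> else 0) / real (n - 1)"
      unfolding sum_divide_distrib by (intro sum.cong refl) (auto simp: h_def sum_divide_distrib intro!: sum.cong)
    finally show ?thesis .
  qed
  have "zrp_dirichlet n (Suc r) f = 1 / 2 * (\<Sum>\<eta>\<in>?\<Omega>. 1 / N * (\<Sum>\<eta>'\<in>?\<Omega>. zrp_rate n \<eta> \<eta>' * (f \<eta> - f \<eta>')\<^sup>2))"
    by (simp add: zrp_dirichlet_def zrp_pi_def zrp_states_eq_conf N_def sum_divide_distrib)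
  also have "\<dots> = 1 / 2 * (\<Sum>\<eta>\<in>?\<Omega>. 1 / N * ((\<Sum>x<n. if 1 \<le> \<eta> x then h x \<eta> else 0) / real (n - 1)))"
    by (simp add: inner)
  also have "\<dots> = (\<Sum>\<eta>\<in>?\<Omega>. \<Sum>x<n. if 1 \<le> \<eta> x then h x \<eta> else 0) / (2 * real (n - 1) * N)"
    by (simp add: sum_divide_distrib[symmetric] mult_ac)
  also have "(\<Sum>\<eta>\<in>?\<Omega>. \<Sum>x<n. if 1 \<le> \<eta> x then h x \<eta> else 0) = (\<Sum>\<xi>\<in>conf ?X r. \<Sum>x<n. h x (inc x \<xi>))"
    by (rule sum_conf_inc[symmetric]) simp
  also have "\<dots> = conf_energy ?X r f"
  proof -
    have "zrp_move (inc x \<xi>) x y = inc y \<xi>" if "x \<noteq> y" for x y \<xi>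
      using that by (auto simp: zrp_move_def inc_def fun_eq_iff)
    then show ?thesis unfolding conf_energy_def h_def by (intro sum.cong refl) auto
  qed
  finally show ?thesis by (simp add: N_def)
qed

text \<open>The occupation number of site 0 differs between all particles at 0 and all particles at
  1. It shows that the infimum in \<open>zrp_gap\<close> runs over a nonempty set.\<close>

lemma zrp_var_neq_0:
  assumes "2 \<le> n" "1 \<le> r"
  shows "zrp_var n r (\<lambda>\<eta>. real (\<eta> 0)) \<noteq> 0"
proof
  let ?\<Omega> = "conf {..<n} r" and ?f = "\<lambda>\<eta> :: nat \<Rightarrow> nat. real (\<eta> 0)"
  assume "zrp_var n r ?f = 0"
  moreover have "card ?\<Omega> > 0" using assms by (intro card_conf_pos) (auto simp: lessThan_empty_iff)
  ultimately have "conf_var {..<n} r ?f = 0" by (simp add: zrp_var_eq)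
  then have eq: "?f \<eta> = conf_mean {..<n} r ?f" if "\<eta> \<in> ?\<Omega>" for \<eta>
    using that by (simp add: conf_var_def sum_nonneg_eq_0_iff finite_conf)
  have d: "(\<lambda>i. if i = x then r else 0) \<in> ?\<Omega>" if "x < n" for x
    using that by (auto simp: conf_def)
  from eq[OF d[of 0]] eq[OF d[of 1]] assms show False by simp
qed

theorem theorem3:
  shows "\<exists>C::real. C > 0 \<and> (\<forall>n r::nat. 2 \<le> n \<longrightarrow> 1 \<le> r \<longrightarrow>
           zrp_relax_time n r \<le> C * (real r / real n + 1)^2)"
proof -
  obtain A where A: "A > 0" "\<And>m. m \<ge> 1 \<Longrightarrow> conf_poincare A m"
    using conf_poincare_uniform by blast
  have "zrp_relax_time n r \<le> 2 * A * (real r / real n + 1)\<^sup>2" if n: "2 \<le> n" and r: "1 \<le> r" for n r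
  proof -
    define L where "L = 2 * A * (real r / real n + 1)\<^sup>2"
    have "real r / real n + 1 > 0" by (simp add: add_nonneg_pos)
    then have L0: "L > 0" using A by (simp add: L_def)
    obtain s where s: "r = Suc s" using r by (cases r) auto
    define N where "N = real (card (conf {..<n} r))"
    have N0: "N > 0" unfolding N_def using n card_conf_pos[of "{..<n}" r] by (auto simp: lessThan_empty_iff)
    let ?Q = "{zrp_dirichlet n r f / zrp_var n r f | f. zrp_var n r f \<noteq> 0}"
    have "1 / L \<le> q" if "q \<in> ?Q" for q
    proof -
      obtain f where f: "q = zrp_dirichlet n r f / zrp_var n r f" "zrp_var n r f \<noteq> 0"
        using \<open>q \<in> ?Q\<close> by blast
      define E where "E = conf_energy {..<n} s f"
      have E0: "E \<ge> 0" unfolding E_def by (rule conf_energy_nonneg)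
      have D: "zrp_dirichlet n r f = E / (2 * real (n - 1) * N)"
        unfolding s zrp_dirichlet_eq E_def N_def ..
      have "conf_var {..<n} r f \<ge> 0" unfolding conf_var_def by (intro sum_nonneg) auto
      then have "zrp_var n r f \<ge> 0" unfolding zrp_var_eq by simp
      then have V0: "zrp_var n r f > 0" using f(2) by linarith
      have "conf_var {..<n} r f \<le> A * (real n + real r)\<^sup>2 / real n ^ 3 * E"
        using A(2)[of n] n unfolding conf_poincare_def s E_def by auto
      also have "\<dots> = A * (real r / real n + 1)\<^sup>2 * E / real n"
        using n by (simp add: field_simps power2_eq_square power3_eq_cube)
      \<comment> \<open>Passing to \<open>n - 1\<close> matches the jump rate; the factor 2 in
        \<open>L\<close> then compensates the 1/2 of the Dirichlet form.\<close>
      also have "\<dots> \<le> A * (real r / real n + 1)\<^sup>2 * E / real (n - 1)"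
        using n A E0 by (intro divide_left_mono) auto
      finally have "zrp_var n r f \<le> A * (real r / real n + 1)\<^sup>2 * E / real (n - 1) / N"
        unfolding zrp_var_eq N_def by (intro divide_right_mono) auto
      also have "\<dots> = L * zrp_dirichlet n r f" unfolding D L_def by simp
      finally show ?thesis using V0 L0 by (simp add: f(1) field_simps)
    qed
    moreover have "?Q \<noteq> {}" using zrp_var_neq_0[OF n r] by blast
    ultimately have gap: "1 / L \<le> zrp_gap n r" unfolding zrp_gap_def by (intro cInf_greatest)
    have "0 < 1 / L" using L0 by simp
    then have "0 < zrp_gap n r" using gap by (rule less_le_trans)
    then have "1 / zrp_gap n r \<le> L" using gap L0 by (simp add: field_simps)
    then show ?thesis by (simp add: zrp_relax_time_def L_def)
  qed
  moreover have "2 * A > 0" using A by simp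
  ultimately show ?thesis by blast
qed

end
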